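(* A permutation matrix $P$ has linear saturation function (i.e. $\mathrm{sat}(P,n) \in \Theta(n)$) if and only if it is decomposable; otherwise $\mathrm{sat}(P,n) \in \mathcal{O}(1)$.
   Context: All matrices are 0-1 matrices; a pattern is a matrix that is not all-zero. A matrix $M$ contains a pattern $P$ if $P$ can be obtained from $M$ by deleting rows and/or columns and turning arbitrary 1-entries into 0s; otherwise $M$ avoids $P$. A matrix $M$ is $P$-saturating if it avoids $P$ but changing any 0-entry of $M$ into a 1 creates an occurrence of $P$. The saturation function $\mathrm{sat}(P,n)$ is the minimum number of 1-entries in an $n \times n$ $P$-saturating matrix. A permutation matrix has exactly one 1-entry in each row and each column. A pattern $P$ is decomposable if it has the form $\begin{pmatrix} A & \mathbf{0} \\ \mathbf{0} & B \end{pmatrix}$ or $\begin{pmatrix} \mathbf{0} & A \\ B & \mathbf{0} \end{pmatrix}$ for two matrices $A, B \neq \mathbf{0}$, where $\mathbf{0}$ denotes an all-0 matrix of the appropriate size; otherwise it is indecomposable. Fulek and Keszegh showed that every pattern has saturation function either in $\mathcal{O}(1)$ or in $\Theta(n)$, and that every decomposable pattern has linear saturation function. *)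

theory Defs
  imports
    "Jordan_Normal_Form.Matrix"
    "Jordan_Normal_Form.DL_Submatrix"
    "HOL-Library.Landau_Symbols"
begin

text \<open>
  A 0-1 matrix is a \<^typ>\<open>bool mat\<close>, with \<^term>\<open>True\<close> for the entry 1 and \<^term>\<open>False\<close> for the
  entry 0. Rows and columns are indexed from 0.
\<close>

definition one_entries :: "bool mat \<Rightarrow> (nat \<times> nat) set" where
  "one_entries M = {(i, j). i < dim_row M \<and> j < dim_col M \<and> M $$ (i, j)}"

definition all_zero_mat :: "nat \<Rightarrow> nat \<Rightarrow> bool mat" where
  "all_zero_mat r c = mat r c (\<lambda>_. False)"

definition is_pattern :: "bool mat \<Rightarrow> bool" where
  "is_pattern P \<longleftrightarrow> P \<noteq> all_zero_mat (dim_row P) (dim_col P)"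

text \<open>
  \<^term>\<open>submatrix M I J\<close> keeps exactly the rows in \<open>I\<close> and the columns in \<open>J\<close>, in their original
  order (indices outside \<open>M\<close> are ignored), i.e. it deletes the other rows and columns.
\<close>

definition contains :: "bool mat \<Rightarrow> bool mat \<Rightarrow> bool" where
  "contains M P \<longleftrightarrow>
     (\<exists>I J. dim_row (submatrix M I J) = dim_row P \<and>
            dim_col (submatrix M I J) = dim_col P \<and>
            one_entries P \<subseteq> one_entries (submatrix M I J))"

abbreviation avoids :: "bool mat \<Rightarrow> bool mat \<Rightarrow> bool" where
  "avoids M P \<equiv> \<not> contains M P"

definition saturating :: "bool mat \<Rightarrow> bool mat \<Rightarrow> bool" where
  "saturating P M \<longleftrightarrow>
     avoids M P \<and>
     (\<forall>i < dim_row M. \<forall>j < dim_col M. \<not> M $$ (i, j) \<longrightarrow> contains (M |\<^sub>m (i, j) \<mapsto> True) P)"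

text \<open>
  The minimum below is attained for every pattern \<open>P\<close>; see the lemma \<open>sat_attained\<close>.
\<close>

definition sat :: "bool mat \<Rightarrow> nat \<Rightarrow> nat" where
  "sat P n = (LEAST k. \<exists>M \<in> carrier_mat n n. saturating P M \<and> card (one_entries M) = k)"

definition permutation_matrix :: "bool mat \<Rightarrow> bool" where
  "permutation_matrix P \<longleftrightarrow>
     (\<forall>i < dim_row P. \<exists>!j. j < dim_col P \<and> P $$ (i, j)) \<and>
     (\<forall>j < dim_col P. \<exists>!i. i < dim_row P \<and> P $$ (i, j))"

text \<open>
  The diagonal blocks \<open>A\<close>, \<open>B\<close> (resp. the antidiagonal ones) need not be square; being distinct from
  an all-0 matrix is being a pattern.
\<close>

definition decomposable :: "bool mat \<Rightarrow> bool" where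
  "decomposable P \<longleftrightarrow>
     (\<exists>A B. is_pattern A \<and> is_pattern B \<and>
       (P = four_block_mat A (all_zero_mat (dim_row A) (dim_col B))
                           (all_zero_mat (dim_row B) (dim_col A)) B \<or>
        P = four_block_mat (all_zero_mat (dim_row A) (dim_col B)) A
                           B (all_zero_mat (dim_row B) (dim_col A))))"

lemma finite_one_entries: "finite (one_entries M)"
  by (rule finite_subset[of _ "{..<dim_row M} \<times> {..<dim_col M}"]) (auto simp: one_entries_def)

lemma card_one_entries_le: "card (one_entries M) \<le> dim_row M * dim_col M"
proof -
  have "card (one_entries M) \<le> card ({..<dim_row M} \<times> {..<dim_col M})"
    by (rule card_mono) (auto simp: one_entries_def)
  then show ?thesis by (simp add: card_cartesian_product)
qed

lemma is_pattern_iff: "is_pattern P \<longleftrightarrow> one_entries P \<noteq> {}"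
  by (auto simp: is_pattern_def all_zero_mat_def one_entries_def mat_eq_iff)

lemma all_zero_avoids:
  assumes "is_pattern P"
  shows "avoids (all_zero_mat r c) P"
proof
  assume "contains (all_zero_mat r c) P"
  then obtain I J where sub: "one_entries P \<subseteq> one_entries (submatrix (all_zero_mat r c) I J)"
    by (auto simp: contains_def)
  obtain i j where "(i, j) \<in> one_entries P"
    using assms by (auto simp: is_pattern_iff)
  with sub have ij: "i < card {i. i < r \<and> i \<in> I}" "j < card {j. j < c \<and> j \<in> J}"
    and one: "submatrix (all_zero_mat r c) I J $$ (i, j)"
    by (auto simp: one_entries_def dim_submatrix all_zero_mat_def)
  from ij have "pick I i < r" "pick J j < c"
    by (auto intro: pick_le)
  with one ij show False
    by (simp add: submatrix_index all_zero_mat_def)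
qed

lemma saturating_exists:
  assumes "is_pattern P"
  shows "\<exists>M \<in> carrier_mat n n. saturating P M"
proof -
  let ?Q = "\<lambda>M. M \<in> carrier_mat n n \<and> avoids M P"
  have "?Q (all_zero_mat n n)"
    using all_zero_avoids[OF assms] by (simp add: all_zero_mat_def)
  moreover have "\<forall>M. ?Q M \<longrightarrow> card (one_entries M) < Suc (n * n)"
  proof (intro allI impI)
    fix M
    assume "?Q M"
    then show "card (one_entries M) < Suc (n * n)"
      using card_one_entries_le[of M] by auto
  qed
  ultimately have "\<exists>M. ?Q M \<and> (\<forall>N. ?Q N \<longrightarrow> card (one_entries N) \<le> card (one_entries M))"
    by (rule ex_has_greatest_nat[where P = ?Q and f = "\<lambda>M. card (one_entries M)"])
  then obtain M where M_max: "?Q M \<and> (\<forall>N. ?Q N \<longrightarrow> card (one_entries N) \<le> card (one_entries M))"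
    by (rule exE)
  then have M: "M \<in> carrier_mat n n" "avoids M P"
    by simp_all
  have "contains (M |\<^sub>m (i, j) \<mapsto> True) P"
    if ij: "i < dim_row M" "j < dim_col M" "\<not> M $$ (i, j)" for i j
  proof (rule ccontr)
    assume av: "avoids (M |\<^sub>m (i, j) \<mapsto> True) P"
    have "(M |\<^sub>m (i, j) \<mapsto> True) \<in> carrier_mat n n"
      by (rule carrier_matI) (simp_all only: dim_update_mat carrier_matD[OF M(1)])
    with av have "card (one_entries (M |\<^sub>m (i, j) \<mapsto> True)) \<le> card (one_entries M)"
      using M_max by simp
    moreover have "one_entries (M |\<^sub>m (i, j) \<mapsto> True) = insert (i, j) (one_entries M)"
      using ij by (auto simp: one_entries_def update_mat_def)
    moreover have "(i, j) \<notin> one_entries M"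
      using ij by (simp add: one_entries_def)
    ultimately show False
      by (simp add: finite_one_entries)
  qed
  with M(2) have "saturating P M"
    by (simp add: saturating_def)
  with M(1) show ?thesis by (rule bexI[rotated])
qed

lemma sat_attained:
  assumes "is_pattern P"
  shows "\<exists>M \<in> carrier_mat n n. saturating P M \<and> card (one_entries M) = sat P n"
  unfolding sat_def by (rule LeastI_ex) (use saturating_exists[OF assms, of n] in blast)

lemma sat_le:
  assumes "M \<in> carrier_mat n n" "saturating P M"
  shows "sat P n \<le> card (one_entries M)"
  unfolding sat_def by (rule Least_le) (use assms in blast)

end

theory Submission
  imports Defs
begin

text \<open>
  A 0-1 matrix is viewed as the set of its 1-entries in the integer grid.

  \<^item> If \<open>P\<close> is decomposable, no row \<open>r\<close> of a saturating matrix is empty: going along \<open>r\<close>, a new entry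
    can play in the left block at the left end and only in the right block at the right end, and where
    this changes the two occurrences combine to one that avoids row \<open>r\<close>. Conversely, spreading \<open>P\<close>
    minus one entry over the four corners leaves only linearly many cells that do not create \<open>P\<close>.

  \<^item> If \<open>P\<close> is indecomposable, it suffices to find a finite \<open>P\<close>-avoiding point set with an empty row all
    of whose (infinitely many) cells create \<open>P\<close>: such a set and its analogue with an empty column are put
    on the diagonal, the empty row and column are repeated, and only boundedly many cells are left over.

  \<^item> To find it, assume that the leftmost entry of \<open>P\<close> lies in a row \<open>lam\<close> above the row \<open>rho\<close> of the
    rightmost entry. As \<open>P\<close> is indecomposable, a zigzag of deepest entries (valleys) and rightmost entries
    (peaks) leads from \<open>lam\<close> to \<open>rho\<close>. Take one copy of \<open>P\<close> for each entry of the zigzag, with that entry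
    removed and its row placed on row 0, and interleave the left and right parts of consecutive copies
    so that the gaps left by the removed entries cover row 0. In each copy the rows above some threshold
    are pushed up and the rows below another threshold are pushed down as far as the height of the
    configuration allows. In an occurrence of \<open>P\<close> this forbids, for every copy, the image of
    one particular entry to lie in that copy. Reading the pieces from left to right, one entry
    after another cannot be placed, until some entry has no piece left.
\<close>

section \<open>Occurrences between point sets\<close>

text \<open>The map \<open>h\<close> need not keep equal coordinates equal. On a
  \<open>perm_set\<close> strict monotonicity already makes it injective, and the loose form lets
  occurrences compose even through sets with several points in a row.\<close>

definition occurs :: "(int \<times> int) set \<Rightarrow> (int \<times> int) set \<Rightarrow> bool" where
  "occurs E S \<longleftrightarrow> (\<exists>h. \<forall>p\<in>E. h p \<in> S \<and>
     (\<forall>q\<in>E. (fst p < fst q \<longrightarrow> fst (h p) < fst (h q)) \<and> (snd p < snd q \<longrightarrow> snd (h p) < snd (h q))))"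

lemma occurs_mono: "occurs E S \<Longrightarrow> S \<subseteq> T \<Longrightarrow> occurs E T"
  unfolding occurs_def by (meson subsetD)

lemma occurs_trans:
  assumes "occurs E S" "occurs S T"
  shows "occurs E T"
proof -
  from assms(1) obtain f where f: "\<forall>p\<in>E. f p \<in> S \<and>
     (\<forall>q\<in>E. (fst p < fst q \<longrightarrow> fst (f p) < fst (f q)) \<and> (snd p < snd q \<longrightarrow> snd (f p) < snd (f q)))"
    unfolding occurs_def by blast
  from assms(2) obtain g where g: "\<forall>p\<in>S. g p \<in> T \<and>
     (\<forall>q\<in>S. (fst p < fst q \<longrightarrow> fst (g p) < fst (g q)) \<and> (snd p < snd q \<longrightarrow> snd (g p) < snd (g q)))"
    unfolding occurs_def by blast
  from f g show ?thesis unfolding occurs_def by (intro exI[of _ "g \<circ> f"]) auto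
qed

lemma occursI_maps:
  assumes "\<And>p. p \<in> E \<Longrightarrow> (f (fst p), g (snd p)) \<in> S"
    and "\<And>p q. p \<in> E \<Longrightarrow> q \<in> E \<Longrightarrow> fst p < fst q \<Longrightarrow> f (fst p) < f (fst q)"
    and "\<And>p q. p \<in> E \<Longrightarrow> q \<in> E \<Longrightarrow> snd p < snd q \<Longrightarrow> g (snd p) < g (snd q)"
  shows "occurs E S"
  unfolding occurs_def using assms by (intro exI[of _ "map_prod f g"]) (auto simp: map_prod_def split_beta)

text \<open>Strictly increasing coordinate maps can be undone on their range, so inserting empty
  rows or columns creates no new occurrence.\<close>

lemma occurs_map_prodD:
  assumes "occurs E (map_prod f g ` S)" "strict_mono f" "strict_mono g"
  shows "occurs E S"
proof -
  have inv: "inv_into UNIV f (f x) = x" "inv_into UNIV g (g x) = x" for x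
    using assms(2,3) by (simp_all add: strict_mono_imp_inj_on)
  have less: "f x < f y \<longleftrightarrow> x < y" "g x < g y \<longleftrightarrow> x < y" for x y
    using assms(2,3) by (simp_all add: strict_mono_less)
  have "occurs (map_prod f g ` S) S"
    by (rule occursI_maps[where f = "inv_into UNIV f" and g = "inv_into UNIV g"]) (auto simp: inv less)
  with assms(1) show ?thesis by (rule occurs_trans)
qed

definition perm_set :: "(int \<times> int) set \<Rightarrow> bool" where
  "perm_set E \<longleftrightarrow> finite E \<and> inj_on fst E \<and> inj_on snd E"

text \<open>
  \<open>s = 1\<close> describes the block form with \<open>A\<close> and \<open>B\<close> on the diagonal, \<open>s = -1\<close> the antidiagonal one; as rows
  are numbered downwards, the left block is the upper one for \<open>s = 1\<close>.
\<close>

definition splits :: "int \<Rightarrow> (int \<times> int) set \<Rightarrow> bool" where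
  "splits s E \<longleftrightarrow> (\<exists>A B. A \<noteq> {} \<and> B \<noteq> {} \<and> E = A \<union> B \<and>
     (\<forall>p\<in>A. \<forall>q\<in>B. snd p < snd q \<and> s * fst p < s * fst q))"

text \<open>Row 0 is the empty row that will later be repeated. The last condition covers all
  integer columns, including those far to either side of \<open>V\<close>.\<close>

definition row_witness :: "(int \<times> int) set \<Rightarrow> (int \<times> int) set \<Rightarrow> bool" where
  "row_witness E V \<longleftrightarrow> finite V \<and> \<not> occurs E V \<and> (\<forall>p\<in>V. fst p \<noteq> 0) \<and> (\<forall>c. occurs E (insert (0, c) V))"

section \<open>The witness of an ascending permutation\<close>

text \<open>The entry in row \<open>i\<close> lies in column \<open>c i\<close>. Only cuts into an
  upper left and a lower right part have to be excluded by \<open>indecomposable\<close>: an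
  antidiagonal cut would put \<open>lam\<close> below \<open>rho\<close>.\<close>

locale ascending_permutation =
  fixes a b K lam rho :: int and c :: "int \<Rightarrow> int"
  assumes inj: "inj_on c {a..b}"
    and bounded: "i \<in> {a..b} \<Longrightarrow> 0 \<le> c i \<and> c i < K"
    and lam: "lam \<in> {a..b}" "i \<in> {a..b} \<Longrightarrow> c lam \<le> c i"
    and rho: "rho \<in> {a..b}" "i \<in> {a..b} \<Longrightarrow> c i \<le> c rho"
    and lam_less_rho: "lam < rho"
    and indecomposable: "y \<in> {a..<b} \<Longrightarrow> \<exists>i\<in>{a..b}. (i \<le> y) \<noteq> (c i \<le> x)"
begin

section \<open>The zigzag of peaks and valleys\<close>

definition peak :: "int \<Rightarrow> int" where
  "peak y = inv_into {a..b} c (Max (c ` {a..y}))"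

definition deepest :: "int \<Rightarrow> int" where
  "deepest y = Max {i \<in> {a..b}. c i \<le> c (peak y)}"

lemma peak:
  assumes "y \<in> {a..b}"
  shows "peak y \<in> {a..y}" and "i \<in> {a..y} \<Longrightarrow> c i \<le> c (peak y)"
proof -
  have "Max (c ` {a..y}) \<in> c ` {a..y}" using assms by (intro Max_in) auto
  then obtain j where j: "j \<in> {a..y}" "c j = Max (c ` {a..y})" by (metis imageE)
  then have "peak y = j"
    unfolding peak_def using assms inj inv_into_f_f[of c "{a..b}" j] by auto
  with j show "peak y \<in> {a..y}" "i \<in> {a..y} \<Longrightarrow> c i \<le> c (peak y)" by auto
qed

lemma deepest:
  assumes "y \<in> {a..b}"
  shows "deepest y \<in> {a..b}" "c (deepest y) \<le> c (peak y)"
    and "i \<in> {a..b} \<Longrightarrow> c i \<le> c (peak y) \<Longrightarrow> i \<le> deepest y"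
proof -
  let ?S = "{i \<in> {a..b}. c i \<le> c (peak y)}"
  have "finite ?S" by (rule finite_subset[of _ "{a..b}"]) auto
  moreover have "y \<in> ?S" using peak(2)[OF assms, of y] assms by auto
  ultimately have "deepest y \<in> ?S" unfolding deepest_def by (intro Max_in) auto
  then show "deepest y \<in> {a..b}" "c (deepest y) \<le> c (peak y)" by auto
  show "i \<in> {a..b} \<Longrightarrow> c i \<le> c (peak y) \<Longrightarrow> i \<le> deepest y"
    unfolding deepest_def using \<open>finite ?S\<close> by (intro Max_ge) auto
qed

lemma c_neq: "i \<in> {a..b} \<Longrightarrow> j \<in> {a..b} \<Longrightarrow> i \<noteq> j \<Longrightarrow> c i \<noteq> c j"
  using inj by (auto dest: inj_onD)

text \<open>Otherwise the rows up to \<open>y\<close> would be exactly those whose entries lie in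
  columns up to \<open>c (peak y)\<close>, which is a forbidden cut.\<close>

lemma deepest_greater:
  assumes "y \<in> {a..<b}"
  shows "y < deepest y"
proof (rule ccontr)
  assume "\<not> y < deepest y"
  have y: "y \<in> {a..b}" using assms by auto
  have "(i \<le> y) = (c i \<le> c (peak y))" if "i \<in> {a..b}" for i
    using peak(2)[OF y, of i] deepest(3)[OF y, of i] that \<open>\<not> y < deepest y\<close> by auto
  then show False using indecomposable[OF assms, of "c (peak y)"] by auto
qed

lemma deepest_left_of_peak:
  assumes "y \<in> {a..<b}"
  shows "c (deepest y) < c (peak y)"
  using deepest[of y] peak[of y] deepest_greater[OF assms] assms c_neq[of "deepest y" "peak y"] by force

text \<open>If the next peak were not further right, cutting below row \<open>deepest y\<close> and
  right of column \<open>c (peak y)\<close> would separate the entries. The other claims record how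
  successive peaks and valleys interleave.\<close>

lemma next_peak:
  assumes "y \<in> {a..<b}" "deepest y < b"
  shows "c (peak y) < c (peak (deepest y))" "y < peak (deepest y)" "peak (deepest y) < deepest y"
    and "c (peak y) < c (deepest (deepest y))"
proof -
  let ?z = "deepest y"
  have y: "y \<in> {a..b}" and z: "?z \<in> {a..<b}" "?z \<in> {a..b}"
    using assms deepest(1)[of y] by auto
  note yz = deepest_greater[OF assms(1)]
  show lt: "c (peak y) < c (peak ?z)"
  proof (rule ccontr)
    assume le: "\<not> c (peak y) < c (peak ?z)"
    have "(i \<le> ?z) = (c i \<le> c (peak y))" if "i \<in> {a..b}" for i
      using peak(2)[OF z(2), of i] deepest(3)[OF y, of i] that le by auto
    then show False using indecomposable[OF z(1), of "c (peak y)"] by auto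
  qed
  show "y < peak ?z" using lt peak(2)[OF y, of "peak ?z"] peak(1)[OF z(2)] by force
  show "peak ?z < ?z" 
  proof -
    have "peak ?z \<noteq> ?z" using lt deepest_left_of_peak[OF assms(1)] by auto
    then show ?thesis using peak(1)[OF z(2)] by auto
  qed
  show "c (peak y) < c (deepest ?z)"
    using deepest_greater[OF z(1)] deepest(3)[OF y, of "deepest ?z"] deepest(1)[OF z(2)] by force
qed

text \<open>The rows of the valleys are \<open>Y 1\<close>, \<open>Y 2\<close>, \<open>...\<close>, and \<open>X i\<close> is the row of the peak reached from \<open>Y i\<close>.\<close>

definition Y :: "nat \<Rightarrow> int" where
  "Y i = (deepest ^^ i) lam"

definition depth :: nat where
  "depth = (LEAST i. rho \<le> Y (Suc i))"

lemma Y_Suc: "Y (Suc i) = deepest (Y i)"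
  by (simp add: Y_def)

lemma Y_depth: "rho \<le> Y (Suc depth)" and Y_below: "i \<le> depth \<Longrightarrow> Y i < rho"
proof -
  have Y0: "Y 0 = lam" by (simp add: Y_def)
  have "\<exists>i. rho \<le> Y (Suc i)"
  proof (rule ccontr)
    assume "\<nexists>i. rho \<le> Y (Suc i)"
    then have lt: "Y (Suc i) < rho" for i by (auto simp: not_le)
    \<comment> \<open>Valleys strictly descend as long as they stay above \<open>rho\<close>, so
      they cannot do so for \<open>rho - lam\<close> steps.\<close>
    have "lam + int i \<le> Y i \<and> Y i < rho" for i
    proof (induction i)
      case (Suc i)
      have "Y i \<in> {a..<b}" using Suc lam rho by auto
      from deepest_greater[OF this] show ?case using Suc lt[of i] by (auto simp: Y_Suc)
    qed (auto simp: Y0 lam_less_rho)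
    from this[of "nat (rho - lam)"] lam_less_rho show False by auto
  qed
  then show "rho \<le> Y (Suc depth)" unfolding depth_def by (rule LeastI_ex)
  show "Y i < rho" if "i \<le> depth" for i
  proof (cases i)
    case 0 then show ?thesis using Y0 lam_less_rho by simp
  next
    case (Suc j)
    then show ?thesis using not_less_Least[of j "\<lambda>i. rho \<le> Y (Suc i)"] that by (auto simp: depth_def)
  qed
qed

lemma Y_ge: "i \<le> Suc depth \<Longrightarrow> Y i \<in> {lam..b}"
proof (induction i)
  case 0 then show ?case using lam by (auto simp: Y_def)
next
  case (Suc i)
  then have "Y i \<in> {a..<b}" using Y_below[of i] lam rho by auto
  with deepest_greater[OF this] deepest(1)[of "Y i"] Suc show ?case by (auto simp: Y_Suc)
qed

lemma Y_in: "i \<le> depth \<Longrightarrow> Y i \<in> {a..<b}" "i \<le> Suc depth \<Longrightarrow> Y i \<in> {a..b}"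
  using Y_ge[of i] Y_below[of i] lam rho by auto

lemma Y_less: "i \<le> depth \<Longrightarrow> Y i < Y (Suc i)"
  using deepest_greater[OF Y_in(1)] by (simp add: Y_Suc)

definition X :: "nat \<Rightarrow> int" where
  "X i = peak (Y i)"

lemma X_in: "i \<le> depth \<Longrightarrow> X i \<in> {a..Y i}" "i \<le> depth \<Longrightarrow> X i \<in> {a..b}"
  using peak(1)[OF Y_in(2), of i] Y_in(1)[of i] by (auto simp: X_def)

lemma Y_left_of_X: "i \<le> depth \<Longrightarrow> c (Y (Suc i)) < c (X i)"
  using deepest_left_of_peak[OF Y_in(1)] by (simp add: X_def Y_Suc)

lemma step:
  assumes "Suc i \<le> depth"
  shows "c (X i) < c (X (Suc i))" "Y i < X (Suc i)" "X (Suc i) < Y (Suc i)" "c (X i) < c (Y (Suc (Suc i)))"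
  using next_peak[of "Y i"] Y_in(1)[of i] Y_in(1)[of "Suc i"] assms by (auto simp: X_def Y_Suc)

text \<open>All entries below row \<open>Y (Suc i)\<close> lie to the right of the peak
  \<open>X i\<close>, whereas the valley itself lies to its left.\<close>

lemma valley:
  assumes "Suc i \<le> depth" "j \<in> {a..b}" "Y (Suc i) < j"
  shows "c (Y (Suc i)) < c j"
  using deepest(3)[of "Y i" j] deepest_left_of_peak[of "Y i"] Y_in[of i] assms by (force simp: Y_Suc)

lemma X_peak:
  assumes "i \<le> depth" "j \<in> {a..b}" "j < X i"
  shows "c j < c (X i)"
  using peak(2)[of "Y i" j] X_in[OF assms(1)] Y_in[of i] assms c_neq[of j "X i"] by (force simp: X_def)

text \<open>
  The zigzag is \<open>lam\<close>, \<open>Y 1\<close>, \<open>X 1\<close>, \<open>Y 2\<close>, \<open>X 2\<close>, \<open>...\<close>, \<open>X depth\<close>, \<open>rho\<close>; copy \<open>u\<close> misses the entry in row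
  \<open>base u\<close>, and \<open>lo u\<close> and \<open>hi u\<close> are the thresholds beyond which its rows are pushed outwards.
\<close>

definition base :: "nat \<Rightarrow> int" where
  "base u = (if u = 0 then lam else if u = 2 * depth + 1 then rho
     else if even u then X (u div 2) else Y (Suc (u div 2)))"

text \<open>At \<open>u = 0\<close> the truncated subtraction yields \<open>X 0\<close>. The cap in
  \<open>hi\<close> takes effect only for the last copy.\<close>

definition lo :: "nat \<Rightarrow> int" where
  "lo u = X (Suc u div 2 - 1)"

definition hi :: "nat \<Rightarrow> int" where
  "hi u = Y (min (Suc (Suc u div 2)) (Suc depth))"

lemma base_simps: "base 0 = lam" "base (Suc (2 * depth)) = rho" "i < depth \<Longrightarrow> base (Suc (2 * i)) = Y (Suc i)"
    "Suc i \<le> depth \<Longrightarrow> base (Suc (Suc (2 * i))) = X (Suc i)"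
  by (auto simp: base_def)

lemma lo_simps: "lo 0 = X 0" "lo (Suc (2 * i)) = X i" "lo (Suc (Suc (2 * i))) = X i"
  by (auto simp: lo_def)

lemma hi_simps: "hi 0 = Y 1" "hi (Suc (2 * depth)) = Y (Suc depth)"
   "i < depth \<Longrightarrow> hi (Suc (2 * i)) = Y (Suc (Suc i))" "i < depth \<Longrightarrow> hi (Suc (Suc (2 * i))) = Y (Suc (Suc i))"
  by (auto simp: hi_def min_def)

lemma copy_cases:
  assumes "u \<le> 2 * depth + 1"
  obtains "u = 0" | i where "i < depth" "u = Suc (2 * i)" | i where "i < depth" "u = Suc (Suc (2 * i))" | "u = Suc (2 * depth)"
proof (cases "u = 0 \<or> u = Suc (2 * depth)")
  case False
  then obtain i where "u = Suc (2 * i) \<or> u = Suc (Suc (2 * i))" by (metis oddE evenE Suc_eq_plus1 not0_implies_Suc even_Suc)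
  with False assms that show ?thesis by auto
qed (use that in auto)

text \<open>The first group of inequalities puts the missing row between the two thresholds; the
  bounds by \<open>lam\<close> and \<open>rho\<close> ensure that the shifts beyond the thresholds
  point outwards.\<close>

lemma base_range:
  assumes "u \<le> 2 * depth + 1"
  shows "a \<le> lo u" "lo u \<le> base u" "base u \<le> hi u" "hi u \<le> b" "lam \<le> base u" "base u \<le> rho"
  using assms
proof (atomize (full), cases rule: copy_cases)
  case 1
  then show "(a \<le> lo u \<and> lo u \<le> base u \<and> base u \<le> hi u) \<and> hi u \<le> b \<and> lam \<le> base u \<and> base u \<le> rho"
    using X_in[of 0] Y_less[of 0] Y_ge[of 1] lam_less_rho by (auto simp: base_simps lo_simps hi_simps) (auto simp: Y_def)
next
  case (2 i)
  then show "(a \<le> lo u \<and> lo u \<le> base u \<and> base u \<le> hi u) \<and> hi u \<le> b \<and> lam \<le> base u \<and> base u \<le> rho"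
    using X_in[of i] Y_less[of i] Y_less[of "Suc i"] Y_ge[of "Suc i"] Y_ge[of "Suc (Suc i)"] Y_below[of "Suc i"]
    by (auto simp: base_simps lo_simps hi_simps)
next
  case (3 i)
  then show "(a \<le> lo u \<and> lo u \<le> base u \<and> base u \<le> hi u) \<and> hi u \<le> b \<and> lam \<le> base u \<and> base u \<le> rho"
    using X_in[of i] step[of i] Y_less[of "Suc i"] Y_ge[of i] Y_ge[of "Suc (Suc i)"] Y_below[of "Suc i"]
    by (auto simp: base_simps lo_simps hi_simps)
next
  case 4
  then show "(a \<le> lo u \<and> lo u \<le> base u \<and> base u \<le> hi u) \<and> hi u \<le> b \<and> lam \<le> base u \<and> base u \<le> rho"
    using X_in[of depth] Y_below[of depth] Y_depth Y_ge[of "Suc depth"] lam_less_rho by (auto simp: base_simps lo_simps hi_simps)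
qed

section \<open>Row offsets and the interleaved copies\<close>

definition offset :: "nat \<Rightarrow> int \<Rightarrow> int" where
  "offset u i = (if i < lo u then i - rho else if hi u < i then i - lam else i - base u)"

lemma offset_mono: "u \<le> 2 * depth + 1 \<Longrightarrow> i < j \<Longrightarrow> offset u i < offset u j"
  using base_range[of u] by (auto simp: offset_def)

lemma offset_base: "u \<le> 2 * depth + 1 \<Longrightarrow> offset u (base u) = 0"
  using base_range[of u] by (auto simp: offset_def)

text \<open>Rows beyond a threshold attain one of these bounds: they sit at the extreme height that
  any copy allows for them. This is what \<open>not_lo\<close> and \<open>not_hi\<close>
  exploit.\<close>

lemma offset_range: "u \<le> 2 * depth + 1 \<Longrightarrow> i - rho \<le> offset u i \<and> offset u i \<le> i - lam"
  using base_range[of u] by (auto simp: offset_def)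

text \<open>
  The left part of copy \<open>u\<close> occupies the columns of block \<open>2 * u - 2\<close> and its right part those of block
  \<open>2 * u + 1\<close>, so its gap consists of the blocks \<open>2 * u - 1\<close> and \<open>2 * u\<close>.
\<close>

definition witness :: "(int \<times> int) set" where
  "witness = (\<Union>u \<in> {..2 * depth + 1}.
     (\<lambda>i. (offset u i, (2 * int u - 2) * K + c i)) ` {i \<in> {a..b}. c i < c (base u)} \<union>
     (\<lambda>i. (offset u i, (2 * int u + 1) * K + c i)) ` {i \<in> {a..b}. c (base u) < c i})"


definition entries :: "(int \<times> int) set" where
  "entries = (\<lambda>i. (i, c i)) ` {a..b}"

lemma finite_witness: "finite witness"
proof -
  have "finite {i \<in> {a..b}. P i}" for P by (rule finite_subset[of _ "{a..b}"]) auto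
  then show ?thesis by (simp add: witness_def)
qed

lemma witness_nonzero: "p \<in> witness \<Longrightarrow> fst p \<noteq> 0"
proof
  assume "p \<in> witness" "fst p = 0"
  then obtain u i where u: "u \<le> 2 * depth + 1" "offset u i = 0" "c i \<noteq> c (base u)"
    by (auto simp: witness_def)
  then show False
    using offset_mono[OF u(1), of i "base u"] offset_mono[OF u(1), of "base u" i] offset_base[OF u(1)]
    by (cases "i < base u"; cases "base u < i") auto
qed

text \<open>The gaps of consecutive copies tile row 0, and the first and last gaps are unbounded
  because \<open>lam\<close> and \<open>rho\<close> carry the extreme columns. The new cell replaces
  the missing entry of the copy whose gap contains it.\<close>

lemma witness_expandable: "occurs entries (insert (0, d) witness)"
proof -
  have K: "0 < K" using bounded lam(1) by force
  \<comment> \<open>Blocks \<open>2 * q - 1\<close> and \<open>2 * q\<close> are those in the gap of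
    copy \<open>q\<close>. Here \<open>nat\<close> sends every column further left to copy 0, and
    \<open>min\<close> every column further right to the last copy.\<close>
  define q where "q = min (2 * depth + 1) (nat ((d div K + 1) div 2))"
  have q: "q \<le> 2 * depth + 1" by (simp add: q_def)
  define h where "h = (\<lambda>(i, j). (offset q i, if j < c (base q) then (2 * int q - 2) * K + j
      else if c (base q) < j then (2 * int q + 1) * K + j else d))"
  have b: "base q \<in> {a..b}" using base_range[OF q] lam rho by auto
  have left: "(2 * int q - 2) * K + c i < d" if "i \<in> {a..b}" "c i < c (base q)" for i
  proof -
    have "q \<noteq> 0" using that lam(2)[OF that(1)] by (metis base_simps(1) not_le)
    then have "int q \<le> (d div K + 1) div 2" by (simp add: q_def min_def nat_le_iff split: if_splits)
    then have "2 * int q - 1 \<le> d div K" by auto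
    then have "(2 * int q - 1) * K \<le> d" using K
      by (metis mult_right_mono div_mult_mod_eq pos_mod_sign le_add_same_cancel1 order_trans less_imp_le)
    then show ?thesis using bounded[OF that(1)] by (auto simp: algebra_simps)
  qed
  have right: "d < (2 * int q + 1) * K + c i" if "i \<in> {a..b}" "c (base q) < c i" for i
  proof -
    have "q \<noteq> 2 * depth + 1" using that rho(2)[OF that(1)] by (metis base_simps(2) not_le Suc_eq_plus1)
    then have "q = nat ((d div K + 1) div 2)" by (auto simp: q_def min_def)
    then have "(d div K + 1) div 2 \<le> int q" by (simp only: nat_le_iff[symmetric])
    then have "d div K \<le> 2 * int q" by auto
    then have "d div K * K \<le> 2 * int q * K" using K by (intro mult_right_mono) auto
    moreover have "d = d div K * K + d mod K" "d mod K < K" using K by auto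
    ultimately have "d < 2 * int q * K + K" by linarith
    then have "d < (2 * int q + 1) * K" by (simp add: algebra_simps)
    then show ?thesis using bounded[OF that(1)] by auto
  qed
  have K2: "(2 * int q - 2) * K + c i < (2 * int q + 1) * K + c j" if "i \<in> {a..b}" "j \<in> {a..b}" for i j
    using bounded[OF that(1)] bounded[OF that(2)] by (auto simp: algebra_simps)
  have "h (i, c i) \<in> insert (0, d) witness" if i: "i \<in> {a..b}" for i
  proof (cases "i = base q")
    case True then show ?thesis using offset_base[OF q] by (auto simp: h_def)
  next
    case False
    then consider "c i < c (base q)" | "c (base q) < c i" using c_neq[OF i b] by fastforce
    then show ?thesis
    proof cases
      case 1
      then show ?thesis using q i unfolding h_def witness_def by (intro insertI2 UN_I[of q]) auto
    next
      case 2
      then show ?thesis using q i unfolding h_def witness_def by (intro insertI2 UN_I[of q]) auto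
    qed
  qed
  moreover have "snd (h (i, c i)) < snd (h (j, c j))" if "i \<in> {a..b}" "j \<in> {a..b}" "c i < c j" for i j
    using left[OF that(1)] right[OF that(2)] K2[OF that(1,2)] that by (auto simp: h_def)
  ultimately show ?thesis unfolding occurs_def entries_def
    by (intro exI[of _ h]) (auto simp: h_def intro!: offset_mono[OF q])
qed

lemma witness_avoids: "\<not> occurs entries witness"
proof
  assume "occurs entries witness"
  then obtain h where hE: "\<forall>p\<in>entries. h p \<in> witness \<and>
     (\<forall>q\<in>entries. (fst p < fst q \<longrightarrow> fst (h p) < fst (h q)) \<and> (snd p < snd q \<longrightarrow> snd (h p) < snd (h q)))"
    unfolding occurs_def by blast
  have h: "h (i, c i) \<in> witness" "i < j \<Longrightarrow> fst (h (i, c i)) < fst (h (j, c j))"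
      "c i < c j \<Longrightarrow> snd (h (i, c i)) < snd (h (j, c j))" if "i \<in> {a..b}" "j \<in> {a..b}" for i j
    using hE that by (auto simp: entries_def)
  define f where "f i = fst (h (i, c i))" for i
  define t where "t i = snd (h (i, c i)) div K" for i
  have K: "0 < K" using bounded lam(1) by force
  have f_less: "f i < f j" if "i \<in> {a..b}" "j \<in> {a..b}" "i < j" for i j
    using h(2)[OF that(1,2)] that by (auto simp: f_def)
  have t_le: "t i \<le> t j" if "i \<in> {a..b}" "j \<in> {a..b}" "c i < c j" for i j
    using h(3)[OF that(1,2)] that(3) K by (auto simp: t_def intro: zdiv_mono1)
  have mem: "\<exists>u\<le>2 * depth + 1. \<exists>g\<in>{a..b}. f i = offset u g \<and>
      (c g < c (base u) \<and> t i = 2 * int u - 2 \<or> c (base u) < c g \<and> t i = 2 * int u + 1)"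
    if i: "i \<in> {a..b}" for i
  proof -
    from h(1)[OF i i] obtain u g where ug: "u \<le> 2 * depth + 1" "g \<in> {a..b}" "fst (h (i, c i)) = offset u g"
      "c g < c (base u) \<and> snd (h (i, c i)) = (2 * int u - 2) * K + c g \<or>
       c (base u) < c g \<and> snd (h (i, c i)) = (2 * int u + 1) * K + c g"
      by (auto simp: witness_def)
    have "(x * K + c g) div K = x" for x
      using bounded[OF ug(2)] K by (simp add: div_pos_pos_trivial)
    with ug show ?thesis by (auto simp: f_def t_def intro!: exI[of _ u] bexI[of _ g])
  qed
  have f_neq: "f i \<noteq> 0" if "i \<in> {a..b}" for i
    using witness_nonzero[OF h(1)[OF that that]] by (simp add: f_def)
  have gap: "f i + (j - i) \<le> f j" if "i \<in> {a..b}" "j \<in> {a..b}" "i \<le> j" for i j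
    using that(3,2)
  proof (induction j rule: int_ge_induct)
    case (step j)
    then show ?case using f_less[of j "j + 1"] that(1) by auto
  qed simp
  have ab: "a \<in> {a..b}" "b \<in> {a..b}" using lam(1) by auto
  \<comment> \<open>The bound holds for the top row \<open>a\<close> by \<open>offset_range\<close>
    and spreads downwards, since images of consecutive rows differ by at least 1. The upper bound
    starts from row \<open>b\<close>.\<close>
  have f_lower: "i - rho \<le> f i" if i: "i \<in> {a..b}" for i
  proof -
    obtain u g where "u \<le> 2 * depth + 1" "g \<in> {a..b}" "f a = offset u g" using mem[OF ab(1)] by blast
    then show ?thesis using offset_range[of u g] gap[OF ab(1) i] i by auto
  qed
  have f_upper: "f i \<le> i - lam" if i: "i \<in> {a..b}" for i
  proof -
    obtain u g where "u \<le> 2 * depth + 1" "g \<in> {a..b}" "f b = offset u g" using mem[OF ab(2)] by blast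
    then show ?thesis using offset_range[of u g] gap[OF i ab(2)] i by auto
  qed
  \<comment> \<open>If row \<open>base u\<close> is sent above row 0, row \<open>lo u\<close> has to be sent above its own place in copy \<open>u\<close>,
     but the rows there have been pushed up out of reach.\<close>
  have not_lo: "\<not> (t (lo u) = 2 * int u - 2 \<or> t (lo u) = 2 * int u + 1)"
    if u: "u \<le> 2 * depth + 1" and neg: "f (base u) < 0" for u
  proof
    note br = base_range[OF u]
    have l: "lo u \<in> {a..b}" "base u \<in> {a..b}" using br by auto
    assume "t (lo u) = 2 * int u - 2 \<or> t (lo u) = 2 * int u + 1"
    with mem[OF l(1)] obtain g where g: "f (lo u) = offset u g" by (auto; presburger)
    show False
      using f_lower[OF l(1)] gap[OF l br(2)] neg g br by (auto simp: offset_def split: if_splits)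
  qed
  have not_hi: "\<not> (t (hi u) = 2 * int u - 2 \<or> t (hi u) = 2 * int u + 1)"
    if u: "u \<le> 2 * depth + 1" and pos: "0 < f (base u)" for u
  proof
    note br = base_range[OF u]
    have l: "hi u \<in> {a..b}" "base u \<in> {a..b}" using br by auto
    assume "t (hi u) = 2 * int u - 2 \<or> t (hi u) = 2 * int u + 1"
    with mem[OF l(1)] obtain g where g: "f (hi u) = offset u g" by (auto; presburger)
    show False
      using f_upper[OF l(1)] gap[OF l(2,1) br(3)] pos g br by (auto simp: offset_def split: if_splits)
  qed
  \<comment> \<open>Block \<open>4 * k\<close> is the left part of copy \<open>2 * k + 1\<close>,
    which misses a valley; everything to the left of that valley lies above it.\<close>
  have valley_left: "f i < 0" if i: "i \<in> {a..b}" "k < depth" "t i = 4 * int k" for i k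
  proof -
    have "t i \<noteq> 2 * int u + 1" for u using i(3) by presburger
    then obtain u g where ug: "u \<le> 2 * depth + 1" "g \<in> {a..b}" "f i = offset u g"
       "c g < c (base u)" "t i = 2 * int u - 2"
      using mem[OF i(1)] by blast
    then have u: "u = Suc (2 * k)" using i(3) by auto
    then have "c g < c (Y (Suc k))" using i ug u by (simp add: base_simps)
    then have "\<not> Y (Suc k) < g" "g \<noteq> Y (Suc k)" using valley[of k g] i(2) ug by auto
    then have "g < base u" using ug i u by (simp add: base_simps)
    then show ?thesis using offset_mono[OF ug(1), of g "base u"] offset_base[OF ug(1)] ug by auto
  qed
  \<comment> \<open>Block \<open>4 * k + 5\<close> is the right part of copy
    \<open>2 * k + 2\<close>, which misses a peak; everything to the right of that peak lies below
    it.\<close>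
  have peak_right: "0 < f i" if i: "i \<in> {a..b}" "Suc k \<le> depth" "t i = 4 * int k + 5" for i k
  proof -
    have "t i \<noteq> 2 * int u - 2" for u using i(3) by presburger
    then obtain u g where ug: "u \<le> 2 * depth + 1" "g \<in> {a..b}" "f i = offset u g"
       "c (base u) < c g" "t i = 2 * int u + 1"
      using mem[OF i(1)] by blast
    then have u: "u = Suc (Suc (2 * k))" using i(3) by auto
    then have "c (X (Suc k)) < c g" using i ug u by (simp add: base_simps)
    then have "\<not> g < X (Suc k)" "g \<noteq> X (Suc k)" using X_peak[of "Suc k" g] i(2) ug by auto
    then have "base u < g" using ug i u by (simp add: base_simps)
    then show ?thesis using offset_mono[OF ug(1), of "base u" g] offset_base[OF ug(1)] ug by auto
  qed
  have f_rho: "0 < f rho" and f_lam: "f lam < 0"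
    using f_lower[OF rho(1)] f_neq[OF rho(1)] f_upper[OF lam(1)] f_neq[OF lam(1)] by auto
  \<comment> \<open>Copy 0 has no left part and the last copy no right part, which removes block
    \<open>-2\<close> and block \<open>4 * depth + 3\<close>.\<close>
  have t_range: "0 \<le> t i \<and> t i < 4 * int depth + 2" if i: "i \<in> {a..b}" for i
  proof -
    obtain u g where ug: "u \<le> 2 * depth + 1" "g \<in> {a..b}"
      "c g < c (base u) \<and> t i = 2 * int u - 2 \<or> c (base u) < c g \<and> t i = 2 * int u + 1"
      using mem[OF i] by blast
    have "u \<noteq> 0" if "c g < c (base u)" using that lam(2)[OF ug(2)] by (metis base_simps(1) not_le)
    moreover have "u \<noteq> 2 * depth + 1" if "c (base u) < c g"
      using that rho(2)[OF ug(2)] by (metis base_simps(2) not_le Suc_eq_plus1)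
    ultimately show ?thesis using ug by auto
  qed
  have base_even: "base (2 * i) \<in> {a..Y i}" if "i \<le> depth" for i
    using that X_in[of i] lam by (cases i) (auto simp: base_simps Y_def)
  have base_less: "base (2 * i) < base (Suc (2 * i))" if "i \<le> depth" for i
  proof (cases "i = depth")
    case True
    then show ?thesis using base_even[of i] Y_below[of i] by (auto simp: base_simps)
  next
    case False
    then show ?thesis using base_even[of i] Y_less[of i] that by (auto simp: base_simps)
  qed
  \<comment> \<open>\<open>t i\<close> is the block of the image of entry \<open>i\<close>, monotone in the column of \<open>i\<close>. Each step shows
     that no entry from some column on has been placed in the blocks passed so far.\<close>
  have link: "(f (base (2 * i)) < 0 \<longrightarrow> 4 * int i + 2 \<le> t (X i)) \<and>
      (0 < f (base (2 * i)) \<longrightarrow> 4 * int i + 2 \<le> t (Y (Suc i)))"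
    if i: "i \<le> depth" and pre: "f (Y i) < 0 \<Longrightarrow> 4 * int i \<le> t (X i)" "4 * int i \<le> t (Y (Suc i))" for i
  proof -
    have in_ab: "X i \<in> {a..b}" "Y (Suc i) \<in> {a..b}" "Y i \<in> {a..b}" "base (2 * i) \<in> {a..b}"
        "base (Suc (2 * i)) \<in> {a..b}"
      using X_in[OF i] Y_in(2)[of "Suc i"] Y_in(2)[of i] i base_even[OF i] base_range[of "Suc (2 * i)"] lam rho
      by auto
    \<comment> \<open>Copy \<open>2 * i\<close> misses \<open>X i\<close> itself when
      \<open>i\<close> is positive, so the sign of the rows in its right part decides. For
      \<open>i = 0\<close> it misses \<open>lam\<close>, and \<open>not_lo\<close> applies.\<close>
    have X_not: "t (X i) \<noteq> 4 * int i + 1" if "f (base (2 * i)) < 0"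
    proof (cases i)
      case 0
      then show ?thesis using not_lo[of 0] that by (auto simp: lo_simps)
    next
      case (Suc k)
      then show ?thesis using peak_right[OF in_ab(1), of k] that i by (auto simp: base_simps)
    qed
    have X_not': "t (X i) \<noteq> 4 * int i" if "f (base (Suc (2 * i))) < 0"
      using not_lo[of "Suc (2 * i)"] that i by (auto simp: lo_simps)
    \<comment> \<open>Dually, copy \<open>2 * i + 1\<close> misses the valley
      \<open>Y (Suc i)\<close>, except that the last copy misses \<open>rho\<close>, where
      \<open>not_hi\<close> is needed.\<close>
    have Y_not: "t (Y (Suc i)) \<noteq> 4 * int i" if "0 < f (base (Suc (2 * i)))"
    proof (cases "i = depth")
      case True
      then show ?thesis using not_hi[of "Suc (2 * i)"] that by (auto simp: hi_simps)
    next
      case False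
      then show ?thesis using valley_left[OF in_ab(2), of i] that i by (auto simp: base_simps)
    qed
    have Y_not': "t (Y (Suc i)) \<noteq> 4 * int i + 1" if "0 < f (base (2 * i))"
    proof (cases i)
      case 0
      then show ?thesis using that f_lam by (simp add: base_simps)
    next
      case (Suc k)
      then show ?thesis using not_hi[of "2 * i"] that i by (auto simp: hi_simps)
    qed
    have YX: "t (Y (Suc i)) \<le> t (X i)" using t_le[OF in_ab(2,1)] Y_left_of_X[OF i] by auto
    consider "f (base (Suc (2 * i))) < 0" | "f (base (2 * i)) < 0" "0 < f (base (Suc (2 * i)))"
      | "0 < f (base (2 * i))"
      using f_neq[OF in_ab(4)] f_neq[OF in_ab(5)] by fastforce
    then show ?thesis
    proof cases
      case 1
      \<comment> \<open>At \<open>i = depth\<close> the missing row would be \<open>rho\<close>,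
        whose image lies below row 0.\<close>
      then have "i < depth" using f_rho i by (cases "i = depth") (auto simp: base_simps)
      then have "f (Y i) < 0" using 1 f_less[OF in_ab(3,2)] Y_less[OF i] by (auto simp: base_simps)
      moreover have "f (base (2 * i)) < 0" using 1 f_less[OF in_ab(4,5) base_less[OF i]] by simp
      ultimately show ?thesis using pre(1) X_not X_not' 1 by force
    next
      case 2
      then show ?thesis using pre(2) Y_not X_not YX by force
    next
      case 3
      then have "0 < f (base (Suc (2 * i)))" using f_less[OF in_ab(4,5) base_less[OF i]] by simp
      then show ?thesis using 3 pre(2) Y_not Y_not' by force
    qed
  qed
  \<comment> \<open>After blocks 0 to \<open>4 * i + 1\<close>, the sign of the image row of
    \<open>base (2 * i)\<close> tells which of \<open>X i\<close> and \<open>Y (Suc i)\<close> is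
    still unplaced. The induction step first passes blocks \<open>4 * i + 2\<close> and
    \<open>4 * i + 3\<close>; then \<open>link\<close> passes the next two.\<close>
  have inv: "(f (base (2 * i)) < 0 \<longrightarrow> 4 * int i + 2 \<le> t (X i)) \<and>
      (0 < f (base (2 * i)) \<longrightarrow> 4 * int i + 2 \<le> t (Y (Suc i)))" if "i \<le> depth" for i
    using that
  proof (induction i)
    case 0
    have "X 0 \<in> {a..b}" "Y (Suc 0) \<in> {a..b}" using X_in[of 0] Y_in(2)[of "Suc 0"] by auto
    then show ?case by (intro link) (auto simp: t_range)
  next
    case (Suc i)
    then have i: "i \<le> depth" "i < depth" by auto
    note st = step[OF Suc.prems]
    have in_ab: "X i \<in> {a..b}" "Y (Suc i) \<in> {a..b}" "Y (Suc (Suc i)) \<in> {a..b}" "X (Suc i) \<in> {a..b}"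
        "base (2 * i) \<in> {a..b}"
      using X_in[OF i(1)] X_in[OF Suc.prems] Y_in(2)[of "Suc i"] Y_in(2)[of "Suc (Suc i)"] Suc.prems
         base_even[OF i(1)] Y_in(1)[OF i(1)] by auto
    have b1: "f (base (2 * i)) < f (X (Suc i))" using base_even[OF i(1)] st f_less[OF in_ab(5,4)] by auto
    have b2: "f (X (Suc i)) < f (Y (Suc i))" using f_less[OF in_ab(4,2)] st by auto
    have X_not: "t (X i) \<noteq> 4 * int i + 2" if "f (X (Suc i)) < 0"
      using not_lo[of "Suc (Suc (2 * i))"] that Suc.prems by (auto simp: lo_simps base_simps)
    have X_not': "t (X i) \<noteq> 4 * int i + 3" if "f (Y (Suc i)) < 0"
      using not_lo[of "Suc (2 * i)"] that i by (auto simp: lo_simps base_simps)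
    have Y_not: "t (Y (Suc (Suc i))) \<noteq> 4 * int i + 2" if "0 < f (X (Suc i))"
      using not_hi[of "Suc (Suc (2 * i))"] that Suc.prems by (auto simp: hi_simps base_simps)
    have Y_not': "t (Y (Suc (Suc i))) \<noteq> 4 * int i + 3" if "0 < f (Y (Suc i))"
      using not_hi[of "Suc (2 * i)"] that i by (auto simp: hi_simps base_simps)
    have XX: "t (X i) \<le> t (X (Suc i))" using t_le[OF in_ab(1,4)] st by auto
    have XY: "t (X i) \<le> t (Y (Suc (Suc i)))" using t_le[OF in_ab(1,3)] st by auto
    have YX: "t (Y (Suc i)) \<le> t (X i)" using t_le[OF in_ab(2,1)] Y_left_of_X[OF i(1)] by auto
    note IH = Suc.IH[OF i(1)]
    have n: "f (X (Suc i)) \<noteq> 0" "f (Y (Suc i)) \<noteq> 0" "f (base (2 * i)) \<noteq> 0"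
      using f_neq in_ab by auto
    have neg: "4 * int i + 4 \<le> t (X i)" if "f (Y (Suc i)) < 0"
      using that b1 b2 IH X_not X_not' by force
    \<comment> \<open>The columns of \<open>Y (Suc i)\<close>, \<open>X i\<close> and
      \<open>Y (Suc (Suc i))\<close> increase in this order, so every lower bound on a block carries
      over to the next valley.\<close>
    have pos: "4 * int i + 4 \<le> t (Y (Suc (Suc i)))"
    proof (cases "f (Y (Suc i)) < 0")
      case True then show ?thesis using neg XY by auto
    next
      case False
      show ?thesis
      proof (cases "f (X (Suc i)) < 0")
        case True
        then show ?thesis using b1 IH X_not XY Y_not' False n by force
      next
        case F2: False
        have "4 * int i + 2 \<le> t (X i)" using IH n YX by force
        then show ?thesis using XY Y_not Y_not' False F2 n by force
      qed
    qed
    show ?case using neg pos XX by (intro link Suc.prems) auto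
  qed
  \<comment> \<open>For \<open>i = depth\<close> the invariant pushes one of the two entries past
    the last block allowed by \<open>t_range\<close>.\<close>
  have "X depth \<in> {a..b}" "Y (Suc depth) \<in> {a..b}" "base (2 * depth) \<in> {a..b}"
    using X_in[of depth] Y_in(2)[of "Suc depth"] base_even[of depth] Y_in(1)[of depth] by auto
  with t_range[of "X depth"] t_range[of "Y (Suc depth)"] f_neq[of "base (2 * depth)"] inv[of depth] show False by force
qed

end

section \<open>Existence of witnesses\<close>

text \<open>This instantiates the locale with the column function of \<open>E\<close>; a violation
  of \<open>indecomposable\<close> would cut \<open>E\<close> by a row and a column into a diagonal
  splitting.\<close>

lemma row_witness_ascending:
  assumes E: "perm_set E" "fst ` E = {a..b}" "snd ` E \<subseteq> {0..<K}" "\<not> splits 1 E"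
    and l: "l \<in> E" "\<And>p. p \<in> E \<Longrightarrow> snd l \<le> snd p"
    and r: "r \<in> E" "\<And>p. p \<in> E \<Longrightarrow> snd p \<le> snd r"
    and less: "fst l < fst r"
  shows "\<exists>V. row_witness E V"
proof -
  define c where "c i = snd (inv_into E fst i)" for i
  have c: "c (fst p) = snd p" if "p \<in> E" for p
    using E(1) that by (simp add: c_def perm_set_def)
  have E_eq: "E = (\<lambda>i. (i, c i)) ` {a..b}"
    unfolding E(2)[symmetric] image_image using c by force
  have mem: "(i, c i) \<in> E" if "i \<in> {a..b}" for i using that E_eq by blast
  interpret ascending_permutation a b K "fst l" "fst r" c
  proof
    have "inj_on snd E" using E(1) by (simp add: perm_set_def)
    then show "inj_on c {a..b}"
      by (intro inj_onI) (use mem in \<open>metis inj_onD prod.inject snd_conv\<close>)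
    show "i \<in> {a..b} \<Longrightarrow> 0 \<le> c i \<and> c i < K" for i
      using subsetD[OF E(3) imageI[OF mem[of i]]] by simp
    show "fst l \<in> {a..b}" "fst r \<in> {a..b}"
      using imageI[OF l(1), of fst] imageI[OF r(1), of fst] by (simp_all only: E(2))
    show "i \<in> {a..b} \<Longrightarrow> c (fst l) \<le> c i" for i using l(2)[OF mem] c[OF l(1)] by simp
    show "i \<in> {a..b} \<Longrightarrow> c i \<le> c (fst r)" for i using r(2)[OF mem] c[OF r(1)] by simp
    show "fst l < fst r" by fact
    show "\<exists>i\<in>{a..b}. (i \<le> y) \<noteq> (c i \<le> x)" if y: "y \<in> {a..<b}" for x y
    proof (rule ccontr)
      assume *: "\<not> ?thesis"
      have cut: "fst p \<le> y \<longleftrightarrow> snd p \<le> x" if "p \<in> E" for p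
        using * c[OF that] imageI[OF that, of fst] unfolding E(2) by fastforce
      have "splits 1 E" unfolding splits_def
      proof (intro exI conjI)
        show "{p \<in> E. fst p \<le> y} \<noteq> {}" "{p \<in> E. y < fst p} \<noteq> {}"
          using mem[of a] mem[of b] y by auto
        show "\<forall>p\<in>{p \<in> E. fst p \<le> y}. \<forall>q\<in>{p \<in> E. y < fst p}. snd p < snd q \<and> 1 * fst p < 1 * fst q"
          using cut by force
      qed auto
      with E(4) show False by contradiction
    qed
  qed
  have "ascending_permutation.entries a b c = E" by (simp only: entries_def E_eq[symmetric])
  then have "row_witness E witness"
    using finite_witness witness_avoids witness_nonzero witness_expandable by (auto simp: row_witness_def)
  then show ?thesis ..
qed

section \<open>Reflection and transposition\<close>

definition flip :: "int \<times> int \<Rightarrow> int \<times> int" where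
  "flip p = (- fst p, snd p)"

lemma flip_simps [simp]: "fst (flip p) = - fst p" "snd (flip p) = snd p" "flip (flip p) = p"
  by (auto simp: flip_def)

lemma flip_flip_image [simp]: "flip ` flip ` S = S"
  by (simp add: image_image)

lemma occurs_flip: "occurs E S \<Longrightarrow> occurs (flip ` E) (flip ` S)"
  unfolding occurs_def
proof (elim exE)
  fix h assume "\<forall>p\<in>E. h p \<in> S \<and>
     (\<forall>q\<in>E. (fst p < fst q \<longrightarrow> fst (h p) < fst (h q)) \<and> (snd p < snd q \<longrightarrow> snd (h p) < snd (h q)))"
  then show "\<exists>h. \<forall>p\<in>flip ` E. h p \<in> flip ` S \<and>
     (\<forall>q\<in>flip ` E. (fst p < fst q \<longrightarrow> fst (h p) < fst (h q)) \<and> (snd p < snd q \<longrightarrow> snd (h p) < snd (h q)))"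
    by (intro exI[of _ "flip \<circ> h \<circ> flip"]) auto
qed

lemma occurs_swap: "occurs E S \<Longrightarrow> occurs (prod.swap ` E) (prod.swap ` S)"
  unfolding occurs_def
proof (elim exE)
  fix h assume "\<forall>p\<in>E. h p \<in> S \<and>
     (\<forall>q\<in>E. (fst p < fst q \<longrightarrow> fst (h p) < fst (h q)) \<and> (snd p < snd q \<longrightarrow> snd (h p) < snd (h q)))"
  then show "\<exists>h. \<forall>p\<in>prod.swap ` E. h p \<in> prod.swap ` S \<and>
     (\<forall>q\<in>prod.swap ` E. (fst p < fst q \<longrightarrow> fst (h p) < fst (h q)) \<and> (snd p < snd q \<longrightarrow> snd (h p) < snd (h q)))"
    by (intro exI[of _ "prod.swap \<circ> h \<circ> prod.swap"]) auto
qed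

lemma row_witness_flip:
  assumes "row_witness (flip ` E) V"
  shows "row_witness E (flip ` V)"
  unfolding row_witness_def
proof (intro conjI allI)
  show "finite (flip ` V)" "\<forall>p\<in>flip ` V. fst p \<noteq> 0" using assms by (auto simp: row_witness_def)
  show "\<not> occurs E (flip ` V)" using assms occurs_flip[of E "flip ` V"] by (auto simp: row_witness_def)
  show "occurs E (insert (0, c) (flip ` V))" for c
    using assms occurs_flip[of "flip ` E" "insert (0, c) V"] by (auto simp: row_witness_def flip_def[of "(0, c)"])
qed

lemma splits_flip: "splits s (flip ` E) \<Longrightarrow> splits (- s) E"
proof -
  assume "splits s (flip ` E)"
  then obtain A B where "A \<noteq> {}" "B \<noteq> {}" and E: "flip ` E = A \<union> B"
     and "\<forall>p\<in>A. \<forall>q\<in>B. snd p < snd q \<and> s * fst p < s * fst q" unfolding splits_def by blast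
  moreover from E have "E = flip ` A \<union> flip ` B" by (metis flip_flip_image image_Un)
  ultimately show ?thesis unfolding splits_def by (intro exI[of _ "flip ` A"] exI[of _ "flip ` B"]) auto
qed

lemma splits_swap:
  assumes "splits s (prod.swap ` E)" "s = 1 \<or> s = -1"
  shows "splits s E"
proof -
  from assms(1) obtain A B where AB: "A \<noteq> {}" "B \<noteq> {}" and E: "prod.swap ` E = A \<union> B"
     and less: "\<forall>p\<in>A. \<forall>q\<in>B. snd p < snd q \<and> s * fst p < s * fst q" unfolding splits_def by blast
  have "E = prod.swap ` prod.swap ` E" by (simp add: image_image)
  then have E: "E = prod.swap ` A \<union> prod.swap ` B" by (simp only: E image_Un)
  from assms(2) show ?thesis
  proof
    assume "s = 1"
    with AB E less show ?thesis unfolding splits_def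
      by (intro exI[of _ "prod.swap ` A"] exI[of _ "prod.swap ` B"]) auto
  next
    \<comment> \<open>Transposing an antidiagonal form turns the left block into the right one, so
      \<open>A\<close> and \<open>B\<close> change places.\<close>
    assume "s = -1"
    with AB E less show ?thesis unfolding splits_def
      by (intro exI[of _ "prod.swap ` B"] exI[of _ "prod.swap ` A"]) auto
  qed
qed

lemma perm_set_flip: "perm_set E \<Longrightarrow> perm_set (flip ` E)"
  by (auto simp: perm_set_def inj_on_def)

lemma perm_set_swap: "perm_set E \<Longrightarrow> perm_set (prod.swap ` E)"
  by (auto simp: perm_set_def inj_on_def)

text \<open>If the leftmost entry lies below the rightmost one, reversing the rows leads to the
  ascending case and exchanges the two kinds of splitting. Two entries guarantee that leftmost and
  rightmost differ.\<close>

lemma row_witness_exists: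
  assumes E: "perm_set E" "fst ` E = {a..b}" "snd ` E \<subseteq> {0..<K}" "\<not> splits 1 E" "\<not> splits (-1) E"
    and two: "p0 \<in> E" "q0 \<in> E" "p0 \<noteq> q0"
  shows "\<exists>V. row_witness E V"
proof -
  have fin: "finite (snd ` E)" "snd ` E \<noteq> {}" using E(1) two by (auto simp: perm_set_def)
  obtain l where l: "l \<in> E" "\<And>p. p \<in> E \<Longrightarrow> snd l \<le> snd p"
  proof -
    obtain l where "l \<in> E" "Min (snd ` E) = snd l" using Min_in[OF fin] by (rule imageE)
    then show ?thesis using that Min_le[OF fin(1)] by (metis imageI)
  qed
  obtain r where r: "r \<in> E" "\<And>p. p \<in> E \<Longrightarrow> snd p \<le> snd r"
  proof -
    obtain r where "r \<in> E" "Max (snd ` E) = snd r" using Max_in[OF fin] by (rule imageE)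
    then show ?thesis using that Max_ge[OF fin(1)] by (metis imageI)
  qed
  have "snd p0 \<noteq> snd q0" using E(1) two by (auto simp: perm_set_def inj_on_def)
  then have "l \<noteq> r" using l(2) r(2) two by (metis order_antisym order_trans)
  then have "fst l \<noteq> fst r" using E(1) l r by (auto simp: perm_set_def inj_on_def)
  then consider "fst l < fst r" | "fst r < fst l" by linarith
  then show ?thesis
  proof cases
    case 1
    then show ?thesis using row_witness_ascending[OF E(1-4) l r] by simp
  next
    case 2
    have "fst ` flip ` E = uminus ` fst ` E" by (simp add: image_image)
    then have "fst ` flip ` E = {- b..- a}" using E(2) by (simp add: image_uminus_atLeastAtMost)
    moreover have "snd ` flip ` E \<subseteq> {0..<K}" using E(3) by (simp add: image_image)
    moreover have "\<not> splits 1 (flip ` E)" using splits_flip[of 1 E] E(5) by auto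
    ultimately have "\<exists>V. row_witness (flip ` E) V"
      using perm_set_flip[OF E(1)] l r 2
      by (intro row_witness_ascending[where l = "flip l" and r = "flip r"]) auto
    then show ?thesis using row_witness_flip by blast
  qed
qed

section \<open>Bounds on saturated point sets\<close>

definition box :: "nat \<Rightarrow> (int \<times> int) set" where
  "box n = {0..<int n} \<times> {0..<int n}"

definition sat_set :: "(int \<times> int) set \<Rightarrow> nat \<Rightarrow> (int \<times> int) set \<Rightarrow> bool" where
  "sat_set E n S \<longleftrightarrow> S \<subseteq> box n \<and> \<not> occurs E S \<and> (\<forall>p\<in>box n - S. occurs E (insert p S))"

lemma finite_box: "finite (box n)"
  by (simp add: box_def)

text \<open>A maximal avoiding set between \<open>S\<close> and \<open>G\<close> is saturated: cells
  of \<open>G\<close> react by maximality, the others already because of \<open>S\<close>. Bounding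
  the size of \<open>G\<close> thus bounds the saturation function.\<close>

lemma sat_set_completion:
  assumes "S \<subseteq> G" "G \<subseteq> box n" "\<not> occurs E S" "\<And>p. p \<in> box n - G \<Longrightarrow> occurs E (insert p S)"
  shows "\<exists>T. sat_set E n T \<and> T \<subseteq> G"
proof -
  let ?C = "{T. S \<subseteq> T \<and> T \<subseteq> G \<and> \<not> occurs E T}"
  have "finite ?C" by (rule finite_subset[of _ "Pow G"]) (use finite_subset[OF assms(2) finite_box] in auto)
  moreover have "?C \<noteq> {}" using assms by auto
  ultimately have "\<exists>T\<in>?C. \<forall>U\<in>?C. T \<le> U \<longrightarrow> T = U" by (rule finite_has_maximal)
  then obtain T where T: "T \<in> ?C" "\<forall>U\<in>?C. T \<le> U \<longrightarrow> T = U" by (rule bexE)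
  have "occurs E (insert p T)" if p: "p \<in> box n - T" for p
  proof (cases "p \<in> G")
    case True
    then show ?thesis using bspec[OF T(2), of "insert p T"] T(1) p by auto
  next
    case False
    then show ?thesis using assms(4)[of p] p T(1) by (auto intro: occurs_mono)
  qed
  then show ?thesis using T(1) assms(2) unfolding sat_set_def by (intro exI[of _ T]) auto
qed

text \<open>Position \<open>z\<close> is opened into the band \<open>{z..z + N}\<close>. Varying
  \<open>i\<close> moves only the image of \<open>z\<close>, so points off \<open>z\<close> stay
  fixed while the new cell runs through the band.\<close>

definition stretch :: "int \<Rightarrow> int \<Rightarrow> int \<Rightarrow> int \<Rightarrow> int" where
  "stretch z N i v = (if v < z then v else if v = z then i else v + N)"

lemma stretch_less: "i \<in> {z..z + N} \<Longrightarrow> v < w \<Longrightarrow> stretch z N i v < stretch z N i w"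
  by (auto simp: stretch_def)

lemma strict_mono_stretch: "i \<in> {z..z + N} \<Longrightarrow> strict_mono (stretch z N i)"
  by (intro strict_monoI stretch_less)

lemma card_diff_band:
  assumes "0 \<le> z" "0 \<le> N" "z + N < int n"
  shows "card ({0..<int n} - {z..z + N}) = n - nat (N + 1)"
proof -
  have "{z..z + N} \<subseteq> {0..<int n}" using assms by auto
  then show ?thesis by (simp add: card_Diff_subset)
qed

lemma linear_upper_bound:
  assumes E: "perm_set E" "E \<subseteq> box k" "E \<noteq> {}" and n: "k \<le> n"
  shows "\<exists>S. sat_set E n S \<and> card S \<le> 2 * k * n"
proof -
  obtain e1 e2 where e: "(e1, e2) \<in> E" using E(3) by auto
  define N where "N = int n - int k"
  define f where "f = map_prod (stretch e1 N e1) (stretch e2 N e2)"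
  define S where "S = f ` (E - {(e1, e2)})"
  define R where "R = {0..<int n} - {e1..e1 + N}"
  define C where "C = {0..<int n} - {e2..e2 + N}"
  \<comment> \<open>The cells of the box outside \<open>G\<close> form the product of the two bands,
    where a new cell can replace the removed entry.\<close>
  define G where "G = R \<times> {0..<int n} \<union> {0..<int n} \<times> C"
  have N: "0 \<le> N" using n by (simp add: N_def)
  have e_range: "0 \<le> e1" "e1 < int k" "0 \<le> e2" "e2 < int k" using E(2) e by (auto simp: box_def)
  have other: "fst p \<noteq> e1 \<and> snd p \<noteq> e2" if "p \<in> E" "p \<noteq> (e1, e2)" for p
    using E(1) e that by (auto simp: perm_set_def inj_on_def)
  have off: "stretch z N z v \<in> {0..<int n} - {z..z + N}"
    if "v \<noteq> z" "v \<in> {0..<int k}" "z \<in> {0..<int k}" for v z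
    using that n by (auto simp: stretch_def N_def)
  have SG: "S \<subseteq> G"
  proof
    fix p assume "p \<in> S"
    then obtain q where q: "q \<in> E" "q \<noteq> (e1, e2)" "p = f q" by (auto simp: S_def)
    have "fst q \<in> {0..<int k}" "snd q \<in> {0..<int k}" using q(1) E(2) by (auto simp: box_def)
    then have "fst p \<in> R" "snd p \<in> {0..<int n}"
      using off[of "fst q" e1] off[of "snd q" e2] other[OF q(1,2)] e_range by (auto simp: q(3) f_def R_def)
    then show "p \<in> G" by (cases p) (simp add: G_def)
  qed
  \<comment> \<open>Occurrences of a \<open>perm_set\<close> are injective, so \<open>E\<close> does
    not fit into fewer points.\<close>
  have "\<not> occurs E (E - {(e1, e2)})"
  proof
    assume "occurs E (E - {(e1, e2)})"
    then obtain h where h: "\<forall>p\<in>E. h p \<in> E - {(e1, e2)} \<and>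
     (\<forall>q\<in>E. (fst p < fst q \<longrightarrow> fst (h p) < fst (h q)) \<and> (snd p < snd q \<longrightarrow> snd (h p) < snd (h q)))"
      unfolding occurs_def by blast
    have "inj_on h E"
    proof (rule inj_onI)
      fix p q assume pq: "p \<in> E" "q \<in> E" "h p = h q"
      then have "fst p = fst q" using h by (metis less_irrefl linorder_cases)
      then show "p = q" using E(1) pq by (auto simp: perm_set_def inj_on_def)
    qed
    moreover have "h ` E \<subseteq> E - {(e1, e2)}" using h by auto
    ultimately have "card E \<le> card (E - {(e1, e2)})" using E(1) by (intro card_inj_on_le) (auto simp: perm_set_def)
    then show False using E(1) e card_Diff1_less[of E "(e1, e2)"] by (auto simp: perm_set_def)
  qed
  then have avoid: "\<not> occurs E S" unfolding S_def f_def
    using occurs_map_prodD strict_mono_stretch N by (metis atLeastAtMost_iff le_add_same_cancel1 order_refl)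
  have expandable: "occurs E (insert p S)" if p: "p \<in> box n - G" for p
  proof (rule occursI_maps[where f = "stretch e1 N (fst p)" and g = "stretch e2 N (snd p)"])
    have p_range: "fst p \<in> {e1..e1 + N}" "snd p \<in> {e2..e2 + N}"
      using p by (auto simp: G_def R_def C_def box_def)
    show "(stretch e1 N (fst p) (fst q), stretch e2 N (snd p) (snd q)) \<in> insert p S" if q: "q \<in> E" for q
    proof (cases "q = (e1, e2)")
      case True
      then show ?thesis by (simp add: stretch_def)
    next
      case False
      then have "(stretch e1 N (fst p) (fst q), stretch e2 N (snd p) (snd q)) = f q"
        using other[OF q False] by (cases q) (simp add: f_def stretch_def)
      moreover have "f q \<in> S" unfolding S_def using False q by (intro imageI) blast
      ultimately show ?thesis by (simp only: insertI2)
    qed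
    show "stretch e1 N (fst p) (fst q) < stretch e1 N (fst p) (fst q')" if "fst q < fst q'" for q q'
      using p_range(1) that by (rule stretch_less)
    show "stretch e2 N (snd p) (snd q) < stretch e2 N (snd p) (snd q')" if "snd q < snd q'" for q q'
      using p_range(2) that by (rule stretch_less)
  qed
  have "G \<subseteq> box n" by (auto simp: G_def R_def C_def box_def)
  then obtain T where T: "sat_set E n T" "T \<subseteq> G"
    using sat_set_completion[OF SG _ avoid expandable] by blast
  have "card R \<le> k" "card C \<le> k"
    using card_diff_band[of e1 N n] card_diff_band[of e2 N n] e_range N n by (auto simp: R_def C_def N_def)
  then have "card (R \<times> {0..<int n}) \<le> k * n" "card ({0..<int n} \<times> C) \<le> k * n"
    by (simp_all add: card_cartesian_product mult.commute[of n])
  moreover have "card G \<le> card (R \<times> {0..<int n}) + card ({0..<int n} \<times> C)"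
    unfolding G_def by (rule card_Un_le)
  moreover have "card T \<le> card G" using T(2) by (rule card_mono[rotated]) (auto simp: G_def R_def C_def)
  ultimately show ?thesis using T(1) by (intro exI[of _ T]) auto
qed

lemma linear_lower_bound:
  assumes E: "perm_set E" "splits s E" and S: "sat_set E n S"
  shows "n \<le> card S"
proof -
  from E(2) obtain A B where AB: "A \<noteq> {}" "B \<noteq> {}" "E = A \<union> B"
    and less: "\<And>p q. p \<in> A \<Longrightarrow> q \<in> B \<Longrightarrow> snd p < snd q \<and> s * fst p < s * fst q"
    unfolding splits_def by blast
  have "r \<in> fst ` S" if r: "r \<in> {0..<int n}" for r
  proof (rule ccontr)
    assume empty: "r \<notin> fst ` S"
    define occ where "occ d h \<longleftrightarrow> (\<forall>p\<in>E. h p \<in> insert (r, d) S \<and>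
      (\<forall>q\<in>E. (fst p < fst q \<longrightarrow> fst (h p) < fst (h q)) \<and> (snd p < snd q \<longrightarrow> snd (h p) < snd (h q))))" for d h
    have occD: "h p \<in> insert (r, d) S" "fst p < fst q \<Longrightarrow> fst (h p) < fst (h q)"
        "snd p < snd q \<Longrightarrow> snd (h p) < snd (h q)" if "occ d h" "p \<in> E" "q \<in> E" for d h p q
      using that by (auto simp: occ_def)
    have ex: "\<exists>h. occ d h" if "d \<in> {0..<int n}" for d
    proof -
      have "(r, d) \<in> box n - S" using r that empty by (force simp: box_def)
      then have "occurs E (insert (r, d) S)" using S by (simp add: sat_set_def)
      then show ?thesis unfolding occurs_def occ_def by blast
    qed
    have hit: "\<exists>x\<in>E. h x = (r, d)" if "occ d h" for d h
    proof (rule ccontr)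
      assume "\<not> ?thesis"
      with that have "occurs E S" unfolding occ_def occurs_def by (intro exI[of _ h]) auto
      with S show False by (simp add: sat_set_def)
    qed
    have in_box: "h p \<in> box n" if "occ d h" "d \<in> {0..<int n}" "p \<in> E" for d h p
      using that S r by (auto simp: occ_def sat_set_def box_def)
    \<comment> \<open>This records that the cell in column \<open>d\<close> can play in the left
      block. It fails at the right end, where no column remains for \<open>B\<close>; at the left
      end no column remains for \<open>A\<close> if the cell plays in \<open>B\<close>, so there it
      must play in \<open>A\<close>.\<close>
    define Q where "Q d \<longleftrightarrow> (\<exists>h x. occ d h \<and> x \<in> A \<and> h x = (r, d))" for d
    have n: "0 \<in> {0..<int n}" "int (n - 1) \<in> {0..<int n}" using r by auto
    have Q0: "Q 0"
    proof -
      obtain h x where h: "occ 0 h" "x \<in> E" "h x = (r, 0)" using ex[OF n(1)] hit by blast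
      have "x \<notin> B"
      proof
        assume "x \<in> B"
        obtain p where "p \<in> A" using AB by auto
        then have "snd (h p) < 0" using h less[of p x] \<open>x \<in> B\<close> AB(3) by (fastforce simp: occ_def)
        then show False using in_box[OF h(1) n(1), of p] \<open>p \<in> A\<close> AB(3) by (auto simp: box_def)
      qed
      then have "x \<in> A" using h(2) AB(3) by blast
      with h show ?thesis unfolding Q_def by blast
    qed
    have Qn: "\<not> Q (int (n - 1))"
    proof
      assume "Q (int (n - 1))"
      then obtain h x where h: "occ (int (n - 1)) h" "x \<in> A" "h x = (r, int (n - 1))" unfolding Q_def by blast
      obtain q where "q \<in> B" using AB by auto
      then have "int (n - 1) < snd (h q)" using h less[of x q] AB(3) by (fastforce simp: occ_def)
      then show False using in_box[OF h(1) n(2), of q] \<open>q \<in> B\<close> AB(3) by (auto simp: box_def)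
    qed
    obtain d where d: "Q (int d)" "\<not> Q (int d + 1)" "d < n - 1"
    proof (rule ccontr)
      assume *: "\<not> thesis"
      have "d \<le> n - 1 \<Longrightarrow> Q (int d)" for d
      proof (induction d)
        case (Suc d)
        then show ?case using * that[of d] by (force simp: add.commute)
      qed (use Q0 in simp)
      with Qn show False by blast
    qed
    obtain g x where g: "occ (int d) g" "x \<in> A" "g x = (r, int d)" using d(1) unfolding Q_def by blast
    have d1: "int d + 1 \<in> {0..<int n}" using d(3) by auto
    obtain h y where h: "occ (int d + 1) h" "y \<in> E" "h y = (r, int d + 1)" using ex[OF d1] hit by blast
    then have y: "y \<in> B" using d(2) AB(3) unfolding Q_def by blast
    \<comment> \<open>Since \<open>y\<close> in \<open>B\<close> is sent to
      \<open>(r, d + 1)\<close> by \<open>h\<close>, the \<open>A\<close> part of \<open>h\<close>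
      keeps to columns up to \<open>d\<close> and to one side of row \<open>r\<close>. Since
      \<open>x\<close> in \<open>A\<close> is sent to \<open>(r, d)\<close> by \<open>g\<close>, the
      \<open>B\<close> part of \<open>g\<close> keeps strictly to the right of \<open>d\<close> and
      to the other side.\<close>
    define k where "k p = (if p \<in> A then h p else g p)" for p
    have disj: "p \<notin> A" if "p \<in> B" for p using less[of p p] that by auto
    have s_less: "s * fst (h p) < s * fst (h q)" if "occ d' h" "p \<in> E" "q \<in> E" "s * fst p < s * fst q" for p q h d'
      using that by (auto simp: occ_def mult_less_cancel_left)
    have kA: "k p \<in> S \<and> s * fst (k p) < s * r \<and> snd (k p) \<le> int d" if "p \<in> A" for p
    proof -
      have p: "p \<in> E" using that AB(3) by blast
      have "snd (h p) < int d + 1" "s * fst (h p) < s * r"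
        using less[OF that y] occD(3)[OF h(1) p h(2)] s_less[OF h(1) p h(2)] h(3) by auto
      then show ?thesis using occD(1)[OF h(1) p p] that by (auto simp: k_def)
    qed
    have kB: "k q \<in> S \<and> s * r < s * fst (k q) \<and> int d < snd (k q)" if "q \<in> B" for q
    proof -
      have q: "q \<in> E" "x \<in> E" using that g(2) AB(3) by blast+
      have "int d < snd (g q)" "s * r < s * fst (g q)"
        using less[OF g(2) that] occD(3)[OF g(1) q(2,1)] s_less[OF g(1) q(2,1)] g(3) by auto
      then show ?thesis using occD(1)[OF g(1) q(1,1)] disj[OF that] by (auto simp: k_def)
    qed
    have cross: "snd (k p) < snd (k q)" "s * fst (k p) < s * fst (k q)" if "p \<in> A" "q \<in> B" for p q
      using kA[OF that(1)] kB[OF that(2)] by auto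
    have "occurs E S" unfolding occurs_def
    proof (intro exI[of _ k] ballI conjI impI)
      fix p q assume pq: "p \<in> E" "q \<in> E"
      show "k p \<in> S" using kA[of p] kB[of p] pq AB(3) by blast
      show "fst (k p) < fst (k q)" if "fst p < fst q"
      proof (cases "p \<in> A"; cases "q \<in> A")
        assume "p \<in> A" "q \<in> A" then show ?thesis using occD(2,3)[OF h(1) pq] that by (simp add: k_def)
      next
        assume "p \<notin> A" "q \<notin> A" then show ?thesis using occD(2,3)[OF g(1) pq] that by (simp add: k_def)
      next
        assume "p \<in> A" "q \<notin> A"
        then have "q \<in> B" using pq AB(3) by auto
        with \<open>p \<in> A\<close> show ?thesis using less[of p q] cross(2)[of p q] that by (auto simp: mult_less_cancel_left)
      next
        assume "p \<notin> A" "q \<in> A"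
        then have "p \<in> B" using pq AB(3) by auto
        with \<open>q \<in> A\<close> show ?thesis using less[of q p] cross(2)[of q p] that by (auto simp: mult_less_cancel_left)
      qed
      show "snd (k p) < snd (k q)" if "snd p < snd q"
      proof (cases "p \<in> A"; cases "q \<in> A")
        assume "p \<in> A" "q \<in> A" then show ?thesis using occD(2,3)[OF h(1) pq] that by (simp add: k_def)
      next
        assume "p \<notin> A" "q \<notin> A" then show ?thesis using occD(2,3)[OF g(1) pq] that by (simp add: k_def)
      next
        assume "p \<in> A" "q \<notin> A"
        then show ?thesis using cross(1)[of p q] pq AB(3) by auto
      next
        assume "p \<notin> A" "q \<in> A"
        then show ?thesis using less[of q p] pq AB(3) that by auto
      qed
    qed
    with S show False by (simp add: sat_set_def)
  qed
  then have "{0..<int n} \<subseteq> fst ` S" by blast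
  moreover have fin: "finite S" using S finite_subset[OF _ finite_box] by (auto simp: sat_set_def)
  ultimately have "card {0..<int n} \<le> card (fst ` S)" by (intro card_mono) auto
  also have "\<dots> \<le> card S" using fin by (rule card_image_le)
  finally show ?thesis by simp
qed


lemma bounded_upper_bound:
  assumes E: "perm_set E" "\<not> splits 1 E"
    and V: "row_witness E V" and H': "row_witness (prod.swap ` E) H'"
  shows "\<exists>K. \<forall>n\<ge>K. \<exists>S. sat_set E n S \<and> card S \<le> K * K"
proof -
  define H where "H = prod.swap ` H'"
  have H: "finite H" "\<not> occurs E H" "\<And>p. p \<in> H \<Longrightarrow> snd p \<noteq> 0" "\<And>r. occurs E (insert (r, 0) H)"
  proof -
    have swap: "prod.swap ` prod.swap ` X = X" for X :: "(int \<times> int) set" by (simp add: image_image)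
    show "finite H" "\<And>p. p \<in> H \<Longrightarrow> snd p \<noteq> 0" using H' by (auto simp: H_def row_witness_def)
    show "\<not> occurs E H" using H' occurs_swap[of E H] by (auto simp: H_def row_witness_def swap)
    show "occurs E (insert (r, 0) H)" for r
      using H' occurs_swap[of "prod.swap ` E" "insert (0, r) H'"] by (auto simp: H_def row_witness_def swap)
  qed
  define D where "D = Max (insert 0 ((\<lambda>p. max \<bar>fst p\<bar> \<bar>snd p\<bar>) ` (V \<union> H)))"
  have fin: "finite (insert 0 ((\<lambda>p. max \<bar>fst p\<bar> \<bar>snd p\<bar>) ` (V \<union> H)))"
    using V H(1) by (simp add: row_witness_def)
  have D0: "0 \<le> D" unfolding D_def using fin by (intro Max_ge) auto
  have D: "\<bar>fst p\<bar> \<le> D \<and> \<bar>snd p\<bar> \<le> D" if "p \<in> V \<union> H" for p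
  proof -
    have "max \<bar>fst p\<bar> \<bar>snd p\<bar> \<le> D" unfolding D_def using fin that by (intro Max_ge) blast+
    then show ?thesis by simp
  qed
  define K where "K = nat (4 * D + 2)"
  have "\<exists>S. sat_set E n S \<and> card S \<le> K * K" if n: "K \<le> n" for n
  proof -
    \<comment> \<open>Each witness fits into a square of side \<open>2 * D + 1\<close>; the two
      squares account for \<open>4 * D + 2\<close> rows and columns, and repeating the empty row and
      the empty column absorbs the remaining \<open>N\<close>.\<close>
    define N where "N = int n - (4 * D + 2)"
    have N: "0 \<le> N" "int n = 4 * D + 2 + N" using n D0 by (auto simp: N_def K_def)
    define f where "f = map_prod (\<lambda>r. stretch D N D (r + D)) (\<lambda>c. c + D)"
    define g where "g = map_prod (\<lambda>r. r + 3 * D + N + 1) (\<lambda>c. stretch (3 * D + 1) N (3 * D + 1) (c + 3 * D + 1))"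
    define S where "S = f ` V \<union> g ` H"
    define R where "R = {0..<int n} - {D..D + N}"
    define C where "C = {0..<int n} - {3 * D + 1..3 * D + 1 + N}"
    have fV: "fst (f p) \<in> R \<and> snd (f p) \<in> C \<and> fst (f p) \<le> 2 * D + N \<and> snd (f p) \<le> 2 * D" if "p \<in> V" for p
      using D[of p] that V N D0 by (auto simp: f_def R_def C_def stretch_def row_witness_def)
    have gH: "fst (g p) \<in> R \<and> snd (g p) \<in> C \<and> 2 * D + N < fst (g p) \<and> 2 * D < snd (g p)" if "p \<in> H" for p
      using D[of p] that H(3)[OF that] N D0 by (auto simp: g_def R_def C_def stretch_def)
    have SG: "S \<subseteq> R \<times> C"
    proof
      fix p assume "p \<in> S"
      then obtain v where "v \<in> V \<and> p = f v \<or> v \<in> H \<and> p = g v" unfolding S_def by blast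
      then show "p \<in> R \<times> C" unfolding mem_Times_iff using fV[of v] gH[of v] by auto
    qed
    have sub: "R \<times> C \<subseteq> box n" by (auto simp: R_def C_def box_def)
    have avoid: "\<not> occurs E S"
    proof
      assume "occurs E S"
      then obtain h where h: "\<forall>p\<in>E. h p \<in> S \<and>
        (\<forall>q\<in>E. (fst p < fst q \<longrightarrow> fst (h p) < fst (h q)) \<and> (snd p < snd q \<longrightarrow> snd (h p) < snd (h q)))"
        unfolding occurs_def by blast
      define A where "A = {p \<in> E. h p \<in> f ` V}"
      define B where "B = {p \<in> E. h p \<notin> f ` V}"
      have gB: "h p \<in> g ` H" if "p \<in> B" for p using h that unfolding B_def S_def by blast
      have "B \<noteq> {}"
      proof
        assume "B = {}"
        then have "occurs E (f ` V)" using h unfolding occurs_def B_def by (intro exI[of _ h]) blast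
        moreover have "strict_mono (\<lambda>r. stretch D N D (r + D))" "strict_mono (\<lambda>c. c + D)"
          using N by (auto intro!: strict_monoI stretch_less)
        ultimately have "occurs E V" unfolding f_def by (rule occurs_map_prodD)
        with V show False by (simp add: row_witness_def)
      qed
      moreover have "A \<noteq> {}"
      proof
        assume "A = {}"
        then have "h p \<in> g ` H" if "p \<in> E" for p using gB[of p] that unfolding A_def B_def by blast
        then have "occurs E (g ` H)" using h unfolding occurs_def by (intro exI[of _ h]) blast
        moreover have "strict_mono (\<lambda>r. r + 3 * D + N + 1)"
            "strict_mono (\<lambda>c. stretch (3 * D + 1) N (3 * D + 1) (c + 3 * D + 1))"
          using N by (auto intro!: strict_monoI stretch_less)
        ultimately have "occurs E H" unfolding g_def by (rule occurs_map_prodD)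
        with H(2) show False by contradiction
      qed
      moreover have "E = A \<union> B" unfolding A_def B_def by blast
      \<comment> \<open>The placed copy of \<open>V\<close> lies above and to the left of that of
        \<open>H\<close>, so an occurrence meeting both would split \<open>E\<close>
        diagonally.\<close>
      moreover have "snd p < snd q \<and> 1 * fst p < 1 * fst q" if AB: "p \<in> A" "q \<in> B" for p q
      proof -
        have pq: "p \<in> E" "q \<in> E" "p \<noteq> q" using AB unfolding A_def B_def by blast+
        then have neq: "fst p \<noteq> fst q" "snd p \<noteq> snd q" using E(1) by (auto simp: perm_set_def inj_on_def)
        obtain v w where "h p = f v" "v \<in> V" "h q = g w" "w \<in> H" using AB gB[of q] unfolding A_def by blast
        then have "fst (h p) < fst (h q)" "snd (h p) < snd (h q)" using fV[of v] gH[of w] by auto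
        moreover have "fst q < fst p \<longrightarrow> fst (h q) < fst (h p)" "snd q < snd p \<longrightarrow> snd (h q) < snd (h p)"
          using h pq by blast+
        ultimately show ?thesis using neq by linarith
      qed
      ultimately have "splits 1 E" unfolding splits_def by blast
      with E(2) show False by contradiction
    qed
    have expandable: "occurs E (insert p S)" if p: "p \<in> box n - R \<times> C" for p
    proof -
      from p consider "fst p \<in> {D..D + N}" | "snd p \<in> {3 * D + 1..3 * D + 1 + N}"
        by (cases p) (auto simp: box_def R_def C_def)
      then show ?thesis
      proof cases
        case 1
        \<comment> \<open>Seen from \<open>V\<close>, the cell lies in column
          \<open>snd p - D\<close>, possibly far outside \<open>V\<close>; this is why a witness has
          to react in every column.\<close>
        have "occurs (insert (0, snd p - D) V) (insert p S)"
        proof (rule occursI_maps[where f = "\<lambda>r. stretch D N (fst p) (r + D)" and g = "\<lambda>c. c + D"])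
          fix q assume "q \<in> insert (0, snd p - D) V"
          then consider "q = (0, snd p - D)" | "q \<in> V" by blast
          then show "(stretch D N (fst p) (fst q + D), snd q + D) \<in> insert p S"
          proof cases
            case 2
            then have "fst q \<noteq> 0" using V by (simp add: row_witness_def)
            then have "(stretch D N (fst p) (fst q + D), snd q + D) = f q"
              by (cases q) (simp add: f_def stretch_def)
            with 2 show ?thesis by (simp add: S_def)
          qed (simp add: stretch_def)
        next
          fix q q' :: "int \<times> int" assume "fst q < fst q'"
          then show "stretch D N (fst p) (fst q + D) < stretch D N (fst p) (fst q' + D)"
            by (intro stretch_less[OF 1]) simp
        qed simp
        moreover have "occurs E (insert (0, snd p - D) V)" using V by (simp add: row_witness_def)
        ultimately show ?thesis by (metis occurs_trans)
      next
        case 2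
        have "occurs (insert (fst p - (3 * D + N + 1), 0) H) (insert p S)"
        proof (rule occursI_maps[where f = "\<lambda>r. r + 3 * D + N + 1"
              and g = "\<lambda>c. stretch (3 * D + 1) N (snd p) (c + 3 * D + 1)"])
          fix q assume "q \<in> insert (fst p - (3 * D + N + 1), 0) H"
          then consider "q = (fst p - (3 * D + N + 1), 0)" | "q \<in> H" by blast
          then show "(fst q + 3 * D + N + 1, stretch (3 * D + 1) N (snd p) (snd q + 3 * D + 1)) \<in> insert p S"
          proof cases
            case 2
            then have "snd q \<noteq> 0" by (rule H(3))
            then have "(fst q + 3 * D + N + 1, stretch (3 * D + 1) N (snd p) (snd q + 3 * D + 1)) = g q"
              by (cases q) (simp add: g_def stretch_def)
            with 2 show ?thesis by (simp add: S_def)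
          qed (simp add: stretch_def)
        next
          fix q q' :: "int \<times> int" assume "snd q < snd q'"
          then show "stretch (3 * D + 1) N (snd p) (snd q + 3 * D + 1)
             < stretch (3 * D + 1) N (snd p) (snd q' + 3 * D + 1)"
            by (intro stretch_less[OF 2]) simp
        qed simp
        then show ?thesis using H(4) by (metis occurs_trans)
      qed
    qed
    obtain T where T: "sat_set E n T" "T \<subseteq> R \<times> C"
      using sat_set_completion[OF SG sub avoid expandable] by blast
    have "card R \<le> K" "card C \<le> K"
      using card_diff_band[of D N n] card_diff_band[of "3 * D + 1" N n] N D0 by (auto simp: R_def C_def K_def)
    then have "card (R \<times> C) \<le> K * K" by (simp add: card_cartesian_product mult_le_mono)
    moreover have "card T \<le> card (R \<times> C)" using T(2) by (rule card_mono[rotated]) (auto simp: R_def C_def)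
    ultimately show ?thesis using T(1) by (intro exI[of _ T]) auto
  qed
  then show ?thesis by blast
qed

section \<open>Point sets of matrices\<close>

definition points :: "bool mat \<Rightarrow> (int \<times> int) set" where
  "points M = map_prod int int ` one_entries M"

lemma points_iff: "(x, y) \<in> points M \<longleftrightarrow>
    0 \<le> x \<and> x < int (dim_row M) \<and> 0 \<le> y \<and> y < int (dim_col M) \<and> M $$ (nat x, nat y)"
proof
  assume "(x, y) \<in> points M"
  then show "0 \<le> x \<and> x < int (dim_row M) \<and> 0 \<le> y \<and> y < int (dim_col M) \<and> M $$ (nat x, nat y)"
    by (auto simp: points_def one_entries_def)
next
  assume "0 \<le> x \<and> x < int (dim_row M) \<and> 0 \<le> y \<and> y < int (dim_col M) \<and> M $$ (nat x, nat y)"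
  then show "(x, y) \<in> points M"
    unfolding points_def by (intro image_eqI[of _ _ "(nat x, nat y)"]) (auto simp: one_entries_def)
qed

lemma card_points: "card (points M) = card (one_entries M)"
  unfolding points_def by (rule card_image) (auto simp: inj_on_def)

lemma finite_points: "finite (points M)"
  by (simp add: points_def finite_one_entries)

lemma points_update:
  assumes "i < dim_row M" "j < dim_col M"
  shows "points (M |\<^sub>m (i, j) \<mapsto> True) = insert (int i, int j) (points M)"
proof -
  have "one_entries (M |\<^sub>m (i, j) \<mapsto> True) = insert (i, j) (one_entries M)"
    using assms by (auto simp: one_entries_def update_mat_def)
  then show ?thesis by (simp add: points_def)
qed

lemma points_of_set:
  assumes "S \<subseteq> box n"
  shows "points (mat n n (\<lambda>(i, j). (int i, int j) \<in> S)) = S"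
  using assms by (force simp: points_iff box_def)

section \<open>Submatrices and occurrences\<close>

lemma pick_less:
  assumes "m < n" "n < card {i. i < d \<and> i \<in> I}"
  shows "pick I m < pick I n"
  using assms pick_reduce_set[of m d I] pick_reduce_set[of n d I] pick_mono_le[of n "{i. i < d \<and> i \<in> I}" m]
  by simp

lemma inj_on_lessThan:
  fixes f :: "nat \<Rightarrow> nat"
  assumes f: "\<And>i j. i < j \<Longrightarrow> j < k \<Longrightarrow> f i < f j" and "m \<le> k"
  shows "inj_on f {..<m}"
proof (rule inj_onI)
  fix x y assume "x \<in> {..<m}" "y \<in> {..<m}" "f x = f y"
  then show "x = y" using f[of x y] f[of y x] assms(2) by (cases x y rule: linorder_cases) auto
qed

lemma pick_image:
  assumes f: "\<And>i j. i < j \<Longrightarrow> j < k \<Longrightarrow> f i < f j" and i: "i < (k :: nat)"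
  shows "pick (f ` {..<k}) i = (f i :: nat)"
proof -
  have less: "f a < f i \<longleftrightarrow> a < i" if "a < k" for a
    using f[of a i] f[of i a] i that by (cases a i rule: linorder_cases) auto
  have "{a \<in> f ` {..<k}. a < f i} = f ` {..<i}" using less i by auto
  moreover have "inj_on f {..<i}" using inj_on_lessThan[of k f i] f i by simp
  ultimately have "card {a \<in> f ` {..<k}. a < f i} = i" by (simp add: card_image)
  then show ?thesis using pick_card_in_set[of "f i" "f ` {..<k}"] i by simp
qed

lemma card_image_below:
  assumes f: "\<And>i j. i < j \<Longrightarrow> j < k \<Longrightarrow> f i < f j" and d: "\<And>i. i < k \<Longrightarrow> f i < d"
  shows "card {i. i < (d :: nat) \<and> i \<in> f ` {..<k}} = (k :: nat)"
proof -
  have "{i. i < d \<and> i \<in> f ` {..<k}} = f ` {..<k}" using d by auto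
  moreover have "inj_on f {..<k}" using inj_on_lessThan[of k f k] f by simp
  ultimately show ?thesis by (simp add: card_image)
qed

lemma permutation_matrix_points:
  assumes "permutation_matrix P"
  shows "perm_set (points P)" "fst ` points P = {0..<int (dim_row P)}" "snd ` points P = {0..<int (dim_col P)}"
proof -
  have row: "\<exists>j. j < dim_col P \<and> P $$ (i, j)" "j < dim_col P \<Longrightarrow> P $$ (i, j) \<Longrightarrow> j' < dim_col P \<Longrightarrow> P $$ (i, j') \<Longrightarrow> j = j'"
    if "i < dim_row P" for i j j' using assms that unfolding permutation_matrix_def by blast+
  have col: "\<exists>i. i < dim_row P \<and> P $$ (i, j)" "i < dim_row P \<Longrightarrow> P $$ (i, j) \<Longrightarrow> i' < dim_row P \<Longrightarrow> P $$ (i', j) \<Longrightarrow> i = i'"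
    if "j < dim_col P" for j i i' using assms that unfolding permutation_matrix_def by blast+
  show "perm_set (points P)" unfolding perm_set_def
  proof (intro conjI inj_onI)
    fix p q assume pq: "p \<in> points P" "q \<in> points P"
    obtain x y x' y' where [simp]: "p = (x, y)" "q = (x', y')" by (cases p, cases q) blast
    note pq' = pq[unfolded \<open>p = (x, y)\<close> \<open>q = (x', y')\<close> points_iff]
    show "p = q" if "fst p = fst q" using row(2)[of "nat x" "nat y" "nat y'"] pq' that by (auto simp: nat_less_iff eq_nat_nat_iff)
    show "p = q" if "snd p = snd q" using col(2)[of "nat y" "nat x" "nat x'"] pq' that by (auto simp: nat_less_iff eq_nat_nat_iff)
  qed (rule finite_points)
  show "fst ` points P = {0..<int (dim_row P)}"
  proof (intro equalityI subsetI)
    fix x assume x: "x \<in> {0..<int (dim_row P)}"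
    then have "nat x < dim_row P" by auto
    then obtain j where "j < dim_col P" "P $$ (nat x, j)" using row(1)[of "nat x"] by blast
    then have "(x, int j) \<in> points P" using x by (auto simp: points_iff)
    then show "x \<in> fst ` points P" by force
  qed (auto simp: points_iff)
  show "snd ` points P = {0..<int (dim_col P)}"
  proof (intro equalityI subsetI)
    fix x assume x: "x \<in> {0..<int (dim_col P)}"
    then have "nat x < dim_col P" by auto
    then obtain j where "j < dim_row P" "P $$ (j, nat x)" using col(1)[of "nat x"] by blast
    then have "(int j, x) \<in> points P" using x by (auto simp: points_iff)
    then show "x \<in> snd ` points P" by force
  qed (auto simp: points_iff)
qed

text \<open>Each row and each column of \<open>P\<close> holds exactly one entry, so the image of
  that entry assigns a row or column of \<open>M\<close> to it. These assignments are strictly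
  increasing, and their ranges are the index sets of the submatrix.\<close>

lemma contains_iff_occurs:
  assumes P: "permutation_matrix P"
  shows "contains M P \<longleftrightarrow> occurs (points P) (points M)"
proof
  assume "contains M P"
  then obtain I J where dims: "card {i. i < dim_row M \<and> i \<in> I} = dim_row P" "card {j. j < dim_col M \<and> j \<in> J} = dim_col P"
    and sub: "one_entries P \<subseteq> one_entries (submatrix M I J)"
    by (auto simp: contains_def dim_submatrix)
  show "occurs (points P) (points M)"
  proof (rule occursI_maps[where f = "\<lambda>x. int (pick I (nat x))" and g = "\<lambda>y. int (pick J (nat y))"])
    fix p q assume p: "p \<in> points P" and q: "q \<in> points P"
    from p obtain i j where ij: "(i, j) \<in> one_entries P" "p = (int i, int j)" by (auto simp: points_def)
    then have less: "i < dim_row P" "j < dim_col P" by (auto simp: one_entries_def)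
    from ij sub have "submatrix M I J $$ (i, j)" by (auto simp: one_entries_def)
    then have "M $$ (pick I i, pick J j)" using less dims by (simp add: submatrix_index)
    moreover have "pick I i < dim_row M" "pick J j < dim_col M" using less dims by (simp_all add: pick_le)
    ultimately show "(int (pick I (nat (fst p))), int (pick J (nat (snd p)))) \<in> points M"
      using ij by (simp add: points_iff)
    from q obtain i' j' where ij': "(i', j') \<in> one_entries P" "q = (int i', int j')" by (auto simp: points_def)
    then have less': "i' < dim_row P" "j' < dim_col P" by (auto simp: one_entries_def)
    show "int (pick I (nat (fst p))) < int (pick I (nat (fst q)))" if "fst p < fst q"
      using pick_less[of i i' "dim_row M" I] that ij ij' less' dims by simp
    show "int (pick J (nat (snd p))) < int (pick J (nat (snd q)))" if "snd p < snd q"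
      using pick_less[of j j' "dim_col M" J] that ij ij' less' dims by simp
  qed
next
  note perm = permutation_matrix_points[OF P]
  assume "occurs (points P) (points M)"
  then obtain h where h: "\<forall>p\<in>points P. h p \<in> points M \<and>
     (\<forall>q\<in>points P. (fst p < fst q \<longrightarrow> fst (h p) < fst (h q)) \<and> (snd p < snd q \<longrightarrow> snd (h p) < snd (h q)))"
    unfolding occurs_def by blast
  define f where "f i = nat (fst (h (inv_into (points P) fst (int i))))" for i
  define g where "g j = nat (snd (h (inv_into (points P) snd (int j))))" for j
  have row: "inv_into (points P) fst (int i) \<in> points P \<and> fst (inv_into (points P) fst (int i)) = int i"
    if "i < dim_row P" for i
    using that perm(2) inv_into_into[of "int i" fst "points P"] f_inv_into_f[of "int i" fst "points P"] by simp
  have col: "inv_into (points P) snd (int i) \<in> points P \<and> snd (inv_into (points P) snd (int i)) = int i"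
    if "i < dim_col P" for i
    using that perm(3) inv_into_into[of "int i" snd "points P"] f_inv_into_f[of "int i" snd "points P"] by simp
  have range: "0 \<le> fst (h p) \<and> fst (h p) < int (dim_row M) \<and> 0 \<le> snd (h p) \<and> snd (h p) < int (dim_col M)"
    if "p \<in> points P" for p
  proof -
    have "(fst (h p), snd (h p)) \<in> points M" using h that by simp
    then show ?thesis unfolding points_iff by blast
  qed
  have f: "f i < f j" if "i < j" "j < dim_row P" for i j
  proof -
    have "i < dim_row P" using that by simp
    note ri = row[OF this] and rj = row[OF that(2)]
    have "fst (h (inv_into (points P) fst (int i))) < fst (h (inv_into (points P) fst (int j)))"
      using h ri rj that(1) by simp
    then show ?thesis using range[OF conjunct1[OF ri]] by (simp add: f_def)
  qed
  have g: "g i < g j" if "i < j" "j < dim_col P" for i j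
  proof -
    have "i < dim_col P" using that by simp
    note ri = col[OF this] and rj = col[OF that(2)]
    have "snd (h (inv_into (points P) snd (int i))) < snd (h (inv_into (points P) snd (int j)))"
      using h ri rj that(1) by simp
    then show ?thesis using range[OF conjunct1[OF ri]] by (simp add: g_def)
  qed
  have f_bound: "f i < dim_row M" if "i < dim_row P" for i
    using range[OF conjunct1[OF row[OF that]]] by (simp add: f_def nat_less_iff)
  have g_bound: "g i < dim_col M" if "i < dim_col P" for i
    using range[OF conjunct1[OF col[OF that]]] by (simp add: g_def nat_less_iff)
  let ?I = "f ` {..<dim_row P}" and ?J = "g ` {..<dim_col P}"
  have cards: "card {i. i < dim_row M \<and> i \<in> ?I} = dim_row P" "card {j. j < dim_col M \<and> j \<in> ?J} = dim_col P"
    using card_image_below[of "dim_row P" f "dim_row M"] card_image_below[of "dim_col P" g "dim_col M"]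
      f g f_bound g_bound by blast+
  have "(i, j) \<in> one_entries (submatrix M ?I ?J)" if ij: "(i, j) \<in> one_entries P" for i j
  proof -
    have less: "i < dim_row P" "j < dim_col P" using ij by (auto simp: one_entries_def)
    have p: "(int i, int j) \<in> points P" using ij by (force simp: points_def)
    have "inv_into (points P) fst (int i) = (int i, int j)" "inv_into (points P) snd (int j) = (int i, int j)"
      using perm(1) p inv_into_f_f[of fst "points P" "(int i, int j)"] inv_into_f_f[of snd "points P" "(int i, int j)"]
      by (simp_all add: perm_set_def)
    then have "f i = nat (fst (h (int i, int j)))" "g j = nat (snd (h (int i, int j)))" by (simp_all add: f_def g_def)
    moreover have "(fst (h (int i, int j)), snd (h (int i, int j))) \<in> points M" using h p by simp
    ultimately have "M $$ (f i, g j)" unfolding points_iff by simp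
    moreover have "pick ?I i = f i" "pick ?J j = g j"
      using pick_image[of "dim_row P" f i] pick_image[of "dim_col P" g j] f g less by blast+
    ultimately show ?thesis using less cards by (simp add: one_entries_def dim_submatrix submatrix_index)
  qed
  then show "contains M P" unfolding contains_def using cards by (intro exI[of _ ?I] exI[of _ ?J]) (auto simp: dim_submatrix)
qed

lemma saturating_iff_sat_set:
  assumes P: "permutation_matrix P" and M: "M \<in> carrier_mat n n"
  shows "saturating P M \<longleftrightarrow> sat_set (points P) n (points M)"
proof -
  have dims: "dim_row M = n" "dim_col M = n" using M by auto
  have "points M \<subseteq> box n" by (auto simp: points_iff box_def dims)
  moreover have "(\<forall>i<n. \<forall>j<n. \<not> M $$ (i, j) \<longrightarrow> contains (M |\<^sub>m (i, j) \<mapsto> True) P) \<longleftrightarrow>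
    (\<forall>p\<in>box n - points M. occurs (points P) (insert p (points M)))" (is "?L \<longleftrightarrow> ?R")
  proof
    assume L: ?L
    show ?R
    proof
      fix p assume "p \<in> box n - points M"
      then obtain i j where "p = (int i, int j)" "i < n" "j < n" "\<not> M $$ (i, j)"
        by (cases p) (auto simp: box_def points_iff dims elim!: nonneg_int_cases)
      then show "occurs (points P) (insert p (points M))"
        using L by (simp add: contains_iff_occurs[OF P] points_update dims)
    qed
  next
    assume R: ?R
    show ?L
    proof (intro allI impI)
      fix i j assume ij: "i < n" "j < n" "\<not> M $$ (i, j)"
      then have "(int i, int j) \<in> box n - points M" by (simp add: box_def points_iff)
      then show "contains (M |\<^sub>m (i, j) \<mapsto> True) P"
        using R ij by (simp add: contains_iff_occurs[OF P] points_update dims)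
    qed
  qed
  ultimately show ?thesis unfolding saturating_def sat_set_def dims by (simp add: contains_iff_occurs[OF P])
qed

lemma sat_le_card:
  assumes "permutation_matrix P" "sat_set (points P) n S"
  shows "sat P n \<le> card S"
proof -
  let ?M = "mat n n (\<lambda>(i, j). (int i, int j) \<in> S)"
  have "points ?M = S" using assms(2) by (intro points_of_set) (simp add: sat_set_def)
  then have "saturating P ?M" "card (one_entries ?M) = card S"
    using assms saturating_iff_sat_set[of P ?M n] card_points[of ?M] by auto
  then show ?thesis using sat_le[of ?M n P] by simp
qed

lemma sat_set_attained:
  assumes "is_pattern P" "permutation_matrix P"
  shows "\<exists>S. sat_set (points P) n S \<and> card S = sat P n"
  using sat_attained[OF assms(1), of n] saturating_iff_sat_set[OF assms(2)] card_points by metis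

section \<open>Block decompositions as splittings of point sets\<close>

lemma all_zero_index [simp]: "i < r \<Longrightarrow> j < c \<Longrightarrow> \<not> all_zero_mat r c $$ (i, j)"
  by (simp add: all_zero_mat_def)

lemma dim_all_zero [simp]: "dim_row (all_zero_mat r c) = r" "dim_col (all_zero_mat r c) = c"
  by (simp_all add: all_zero_mat_def)

lemma is_patternI: "i < dim_row A \<Longrightarrow> j < dim_col A \<Longrightarrow> A $$ (i, j) \<Longrightarrow> is_pattern A"
  unfolding is_pattern_iff one_entries_def by blast

lemma is_patternE:
  assumes "is_pattern A"
  obtains i j where "i < dim_row A" "j < dim_col A" "A $$ (i, j)"
  using assms unfolding is_pattern_iff one_entries_def by blast

lemma splits_by_column:
  assumes "p \<in> E" "snd p < x" "q \<in> E" "x \<le> snd q"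
    and "\<And>p q. p \<in> E \<Longrightarrow> q \<in> E \<Longrightarrow> snd p < x \<Longrightarrow> x \<le> snd q \<Longrightarrow> s * fst p < s * fst q"
  shows "splits s E"
  unfolding splits_def
proof (rule exI[of _ "{p \<in> E. snd p < x}"], rule exI[of _ "{p \<in> E. x \<le> snd p}"], intro conjI ballI)
  show "E = {p \<in> E. snd p < x} \<union> {p \<in> E. x \<le> snd p}" by auto
  show "{p \<in> E. snd p < x} \<noteq> {}" "{p \<in> E. x \<le> snd p} \<noteq> {}" using assms(1-4) by blast+
  fix p q assume "p \<in> {p \<in> E. snd p < x}" "q \<in> {p \<in> E. x \<le> snd p}"
  then show "snd p < snd q" "s * fst p < s * fst q" using assms(5)[of p q] by simp_all
qed

lemma decomposable_imp_splits:
  assumes "decomposable P"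
  shows "splits 1 (points P) \<or> splits (-1) (points P)"
proof -
  from assms obtain A B where AB: "is_pattern A" "is_pattern B" and
    "P = four_block_mat A (all_zero_mat (dim_row A) (dim_col B)) (all_zero_mat (dim_row B) (dim_col A)) B \<or>
     P = four_block_mat (all_zero_mat (dim_row A) (dim_col B)) A B (all_zero_mat (dim_row B) (dim_col A))"
    unfolding decomposable_def by blast
  then consider (diag) "P = four_block_mat A (all_zero_mat (dim_row A) (dim_col B)) (all_zero_mat (dim_row B) (dim_col A)) B"
    | (anti) "P = four_block_mat (all_zero_mat (dim_row A) (dim_col B)) A B (all_zero_mat (dim_row B) (dim_col A))"
    by blast
  then show ?thesis
  proof cases
    case diag
    have upper: "fst p < int (dim_row A) \<longleftrightarrow> snd p < int (dim_col A)" if "p \<in> points P" for p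
      using that by (cases p) (auto simp: points_iff diag not_less nat_less_iff split: if_splits)
    obtain i j where "i < dim_row A" "j < dim_col A" "A $$ (i, j)" using AB(1) by (rule is_patternE)
    then have p: "(int i, int j) \<in> points P" by (simp add: points_iff diag)
    obtain i' j' where "i' < dim_row B" "j' < dim_col B" "B $$ (i', j')" using AB(2) by (rule is_patternE)
    then have q: "(int (dim_row A + i'), int (dim_col A + j')) \<in> points P" by (simp add: points_iff diag nat_add_distrib del: of_nat_add)
    have "splits 1 (points P)"
    proof (rule splits_by_column[OF p _ q, of "int (dim_col A)"])
      show "1 * fst p < 1 * fst q"
        if "p \<in> points P" "q \<in> points P" "snd p < int (dim_col A)" "int (dim_col A) \<le> snd q" for p q
        using upper[OF that(1)] upper[OF that(2)] that by auto
    qed (use \<open>j < dim_col A\<close> in auto)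
    then show ?thesis ..
  next
    case anti
    have upper: "fst p < int (dim_row A) \<longleftrightarrow> int (dim_col B) \<le> snd p" if "p \<in> points P" for p
      using that by (cases p) (auto simp: points_iff anti not_less nat_less_iff split: if_splits)
    obtain i j where "i < dim_row A" "j < dim_col A" "A $$ (i, j)" using AB(1) by (rule is_patternE)
    then have q: "(int i, int (dim_col B + j)) \<in> points P" by (simp add: points_iff anti del: of_nat_add)
    obtain i' j' where "i' < dim_row B" "j' < dim_col B" "B $$ (i', j')" using AB(2) by (rule is_patternE)
    then have p: "(int (dim_row A + i'), int j') \<in> points P" by (simp add: points_iff anti del: of_nat_add)
    have "splits (-1) (points P)"
    proof (rule splits_by_column[OF p _ q, of "int (dim_col B)"])
      show "- 1 * fst p < - 1 * fst q"
        if "p \<in> points P" "q \<in> points P" "snd p < int (dim_col B)" "int (dim_col B) \<le> snd q" for p q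
        using upper[OF that(1)] upper[OF that(2)] that by auto
    qed (use \<open>j' < dim_col B\<close> in auto)
    then show ?thesis ..
  qed
qed

lemma splits_imp_decomposable:
  assumes "splits 1 (points P) \<or> splits (-1) (points P)"
  shows "decomposable P"
  using assms
proof
  \<comment> \<open>The least value on \<open>B\<close> separates the two parts; used for rows and
    for columns, it yields the position at which the matrix is cut into blocks.\<close>
  have thr: "\<exists>x. x \<le> m \<and> (\<forall>p\<in>A. f p < int x) \<and> (\<forall>q\<in>B. int x \<le> f q)"
    if "B \<noteq> {}" "B \<subseteq> points P" "\<And>p q. p \<in> A \<Longrightarrow> q \<in> B \<Longrightarrow> f p < f q" "\<And>q. q \<in> B \<Longrightarrow> 0 \<le> f q \<and> f q < int m"
    for A B :: "(int \<times> int) set" and f :: "int \<times> int \<Rightarrow> int" and m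
  proof -
    have fin: "finite (f ` B)" "f ` B \<noteq> {}" using that finite_subset[OF that(2) finite_points] by auto
    obtain q where q: "q \<in> B" "Min (f ` B) = f q" using Min_in[OF fin] by (rule imageE)
    have "f q \<le> f q'" if "q' \<in> B" for q' using Min_le[OF fin(1) imageI[OF that]] q(2) by simp
    then show ?thesis using that(3)[OF _ q(1)] that(4)[OF q(1)] by (intro exI[of _ "nat (f q)"]) auto
  qed
  {
    assume "splits 1 (points P)"
    then obtain S T where ST: "S \<noteq> {}" "T \<noteq> {}" "points P = S \<union> T"
      and "\<forall>p\<in>S. \<forall>q\<in>T. snd p < snd q \<and> 1 * fst p < 1 * fst q"
      unfolding splits_def by blast
    then have less: "snd p < snd q" "fst p < fst q" if "p \<in> S" "q \<in> T" for p q using that by auto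
    have sub: "S \<subseteq> points P" "T \<subseteq> points P" using ST(3) by blast+
    have range: "0 \<le> fst p \<and> fst p < int (dim_row P)" "0 \<le> snd p \<and> snd p < int (dim_col P)"
      if "p \<in> points P" for p using that by (cases p, simp add: points_iff)+
    obtain x where x: "x \<le> dim_row P" "\<forall>p\<in>S. fst p < int x" "\<forall>q\<in>T. int x \<le> fst q"
      using thr[of T S fst "dim_row P", OF ST(2) sub(2) less(2) range(1)[OF subsetD[OF sub(2)]]] by blast
    obtain y where y: "y \<le> dim_col P" "\<forall>p\<in>S. snd p < int y" "\<forall>q\<in>T. int y \<le> snd q"
      using thr[of T S snd "dim_col P", OF ST(2) sub(2) less(1) range(2)[OF subsetD[OF sub(2)]]] by blast
    define A where "A = mat x y (\<lambda>ij. P $$ ij)"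
    define B where "B = mat (dim_row P - x) (dim_col P - y) (\<lambda>(i, j). P $$ (i + x, j + y))"
    have iff: "i < x \<longleftrightarrow> j < y" if "i < dim_row P" "j < dim_col P" "P $$ (i, j)" for i j
    proof -
      have "(int i, int j) \<in> points P" using that by (simp add: points_iff)
      then have "(int i, int j) \<in> S \<union> T" by (simp only: ST(3))
      then show ?thesis
      proof
        assume "(int i, int j) \<in> S"
        from bspec[OF x(2) this] bspec[OF y(2) this] show ?thesis by simp
      next
        assume "(int i, int j) \<in> T"
        from bspec[OF x(3) this] bspec[OF y(3) this] show ?thesis by simp
      qed
    qed
    obtain p where p: "p \<in> S" using ST by blast
    then have p_in: "(fst p, snd p) \<in> points P" using ST(3) by simp
    obtain q where q: "q \<in> T" using ST by blast
    then have q_in: "(fst q, snd q) \<in> points P" using ST(3) by simp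
    have "is_pattern A"
      using p x y p_in[unfolded points_iff]
      by (intro is_patternI[of "nat (fst p)" _ "nat (snd p)"]) (auto simp: A_def nat_less_iff)
    moreover have "is_pattern B"
      using q x y q_in[unfolded points_iff]
      by (intro is_patternI[of "nat (fst q) - x" _ "nat (snd q) - y"]) (auto simp: B_def nat_less_iff le_nat_iff less_diff_conv)
    moreover have "P = four_block_mat A (all_zero_mat (dim_row A) (dim_col B)) (all_zero_mat (dim_row B) (dim_col A)) B"
      using iff x(1) y(1) by (intro eq_matI) (auto simp: A_def B_def)
    ultimately show ?thesis unfolding decomposable_def by blast
  next
    assume "splits (-1) (points P)"
    then obtain S T where ST: "S \<noteq> {}" "T \<noteq> {}" "points P = S \<union> T"
      and "\<forall>p\<in>S. \<forall>q\<in>T. snd p < snd q \<and> -1 * fst p < -1 * fst q"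
      unfolding splits_def by blast
    then have less: "snd p < snd q" "fst q < fst p" if "p \<in> S" "q \<in> T" for p q using that by auto
    have sub: "S \<subseteq> points P" "T \<subseteq> points P" using ST(3) by blast+
    have range: "0 \<le> fst p \<and> fst p < int (dim_row P)" "0 \<le> snd p \<and> snd p < int (dim_col P)"
      if "p \<in> points P" for p using that by (cases p, simp add: points_iff)+
    obtain x where x: "x \<le> dim_row P" "\<forall>p\<in>T. fst p < int x" "\<forall>q\<in>S. int x \<le> fst q"
      using thr[of S T fst "dim_row P"] ST less range by blast
    obtain y where y: "y \<le> dim_col P" "\<forall>p\<in>S. snd p < int y" "\<forall>q\<in>T. int y \<le> snd q"
      using thr[of T S snd "dim_col P", OF ST(2) sub(2) less(1) range(2)[OF subsetD[OF sub(2)]]] by blast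
    define A where "A = mat x (dim_col P - y) (\<lambda>(i, j). P $$ (i, j + y))"
    define B where "B = mat (dim_row P - x) y (\<lambda>(i, j). P $$ (i + x, j))"
    have iff: "i < x \<longleftrightarrow> \<not> j < y" if "i < dim_row P" "j < dim_col P" "P $$ (i, j)" for i j
    proof -
      have "(int i, int j) \<in> points P" using that by (simp add: points_iff)
      then have "(int i, int j) \<in> S \<union> T" by (simp only: ST(3))
      then show ?thesis
      proof
        assume "(int i, int j) \<in> S"
        from bspec[OF x(3) this] bspec[OF y(2) this] show ?thesis by simp
      next
        assume "(int i, int j) \<in> T"
        from bspec[OF x(2) this] bspec[OF y(3) this] show ?thesis by simp
      qed
    qed
    obtain p where p: "p \<in> S" using ST by blast
    then have p_in: "(fst p, snd p) \<in> points P" using ST(3) by simp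
    obtain q where q: "q \<in> T" using ST by blast
    then have q_in: "(fst q, snd q) \<in> points P" using ST(3) by simp
    have "is_pattern A"
      using q x y q_in[unfolded points_iff]
      by (intro is_patternI[of "nat (fst q)" _ "nat (snd q) - y"]) (auto simp: A_def nat_less_iff le_nat_iff less_diff_conv)
    moreover have "is_pattern B"
      using p x y p_in[unfolded points_iff]
      by (intro is_patternI[of "nat (fst p) - x" _ "nat (snd p)"]) (auto simp: B_def nat_less_iff le_nat_iff less_diff_conv)
    moreover have "P = four_block_mat (all_zero_mat (dim_row A) (dim_col B)) A B (all_zero_mat (dim_row B) (dim_col A))"
      using iff x(1) y(1) by (intro eq_matI) (auto simp: A_def B_def)
    ultimately show ?thesis unfolding decomposable_def by blast
  }
qed

section \<open>Growth of the saturation function\<close>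

lemma sat_linear:
  assumes P: "is_pattern P" "permutation_matrix P" and "decomposable P"
  shows "(\<lambda>n. real (sat P n)) \<in> \<Theta>(\<lambda>n. real n)"
proof -
  note perm = permutation_matrix_points[OF P(2)]
  define k where "k = max (dim_row P) (dim_col P)"
  obtain s where s: "splits s (points P)" using decomposable_imp_splits[OF assms(3)] by blast
  have lower: "n \<le> sat P n" for n
    using sat_set_attained[OF P, of n] linear_lower_bound[OF perm(1) s] by metis
  have "points P \<noteq> {}" using P(1) by (simp add: points_def is_pattern_iff)
  moreover have "points P \<subseteq> box k" by (auto simp: points_iff box_def k_def)
  ultimately have upper: "sat P n \<le> 2 * k * n" if "k \<le> n" for n
    using linear_upper_bound[OF perm(1) _ _ that] sat_le_card[OF P(2)] by (metis order_trans)
  have "0 < k"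
    using \<open>points P \<noteq> {}\<close> perm(2) unfolding k_def by (cases "dim_row P = 0") auto
  show ?thesis
  proof (rule bigthetaI'[of 1 "2 * real k"])
    show "eventually (\<lambda>n. 1 * norm (real n) \<le> norm (real (sat P n)) \<and>
        norm (real (sat P n)) \<le> 2 * real k * norm (real n)) at_top"
      using eventually_ge_at_top[of k]
    proof eventually_elim
      case (elim n)
      have "real (sat P n) \<le> real (2 * k * n)" using upper[OF elim] by (simp only: of_nat_le_iff)
      then show ?case using lower[of n] by simp
    qed
  qed (use \<open>0 < k\<close> in auto)
qed

lemma sat_bounded:
  assumes P: "is_pattern P" "permutation_matrix P" and "\<not> decomposable P"
  shows "(\<lambda>n. real (sat P n)) \<in> O(\<lambda>n. 1)"
proof -
  note perm = permutation_matrix_points[OF P(2)]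
  have nosplit: "\<not> splits 1 (points P)" "\<not> splits (-1) (points P)"
    using splits_imp_decomposable assms(3) by blast+
  have "\<exists>K. \<forall>n\<ge>K. \<exists>S. sat_set (points P) n S \<and> card S \<le> K * K"
  proof (cases "\<exists>p\<in>points P. \<exists>q\<in>points P. p \<noteq> q")
    case True
    then obtain p q where pq: "p \<in> points P" "q \<in> points P" "p \<noteq> q" by blast
    let ?E = "points P" and ?E' = "prod.swap ` points P"
    have swap: "fst ` ?E' = snd ` ?E" "snd ` ?E' = fst ` ?E" by (simp_all add: image_image)
    have ivl: "{0..<int m} = {0..int m - 1}" for m by auto
    obtain V where V: "row_witness ?E V"
      using row_witness_exists[of ?E 0 "int (dim_row P) - 1" "int (dim_col P)" p q] perm nosplit pq ivl by auto
    have "prod.swap p \<noteq> prod.swap q" using pq(3) by (metis swap_swap)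
    then obtain H where "row_witness ?E' H"
      using row_witness_exists[of ?E' 0 "int (dim_col P) - 1" "int (dim_row P)" "prod.swap p" "prod.swap q"]
        perm_set_swap[OF perm(1)] perm nosplit splits_swap[of 1 ?E] splits_swap[of "-1" ?E] pq ivl swap by auto
    with V show ?thesis using bounded_upper_bound[OF perm(1) nosplit(1)] by blast
  next
    case False
    have "points P \<noteq> {}" using P(1) by (simp add: points_def is_pattern_iff)
    with False obtain p where p: "points P = {p}" by blast
    \<comment> \<open>For a single entry the empty set is already saturated, since any new cell is
      an occurrence.\<close>
    have "sat_set (points P) n {}" for n
      unfolding p sat_set_def occurs_def by (auto intro: exI[of _ "\<lambda>_. q" for q])
    then show ?thesis by (intro exI[of _ 0]) (auto intro: exI[of _ "{}"])
  qed
  then obtain K where K: "sat P n \<le> K * K" if "K \<le> n" for n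
    using sat_le_card[OF P(2)] by (metis order_trans)
  show ?thesis
  proof (rule bigoI[of _ "real (K * K)"])
    show "eventually (\<lambda>n. norm (real (sat P n)) \<le> real (K * K) * norm (1 :: real)) at_top"
      using eventually_ge_at_top[of K]
    proof eventually_elim
      case (elim n)
      have "real (sat P n) \<le> real (K * K)" using K[OF elim] by (simp only: of_nat_le_iff)
      then show ?case by simp
    qed
  qed
qed

text \<open>Otherwise the identity would be bounded by transitivity. This turns the two growth
  results into an equivalence.\<close>

lemma not_bounded_and_linear:
  fixes f :: "nat \<Rightarrow> real"
  assumes "f \<in> O(\<lambda>n. 1)"
  shows "f \<notin> \<Theta>(\<lambda>n. real n)"
proof
  assume "f \<in> \<Theta>(\<lambda>n. real n)"
  then have "(\<lambda>n. real n) \<in> O(f)" by (simp add: bigtheta_def bigomega_iff_bigo)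
  then have "(\<lambda>n. real n) \<in> O(\<lambda>n. 1)" using assms by (rule landau_o.big_trans)
  then obtain c where "eventually (\<lambda>n. norm (real n) \<le> c * norm (1 :: real)) at_top" by (rule landau_o.bigE)
  then obtain N where "\<forall>n\<ge>N. real n \<le> c" by (auto simp: eventually_at_top_linorder)
  then have "real (max N (nat \<lceil>c\<rceil> + 1)) \<le> c" by simp
  then show False by linarith
qed

theorem theorem1p1:
  fixes P :: "bool mat"
  assumes "is_pattern P" and "permutation_matrix P"
  shows "((\<lambda>n. real (sat P n)) \<in> \<Theta>(\<lambda>n. real n) \<longleftrightarrow> decomposable P) \<and>
         (\<not> decomposable P \<longrightarrow> (\<lambda>n. real (sat P n)) \<in> O(\<lambda>n. 1))"
  using sat_linear[OF assms] sat_bounded[OF assms] not_bounded_and_linear by blast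

end
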